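(* Let $G$ be a finitely generated discrete group with word length $|\cdot|$ (for some finite symmetric generating set) and balls $B_n=\{g\in G:|g|\le n\}$. Assume that $|B_n|\le Le^{Kn^\nu}$ for all $n$, for some $K,L>0$ and $\nu\in(0,1]$, and that $|B_n|$ is more than quadratic in $n$. Then for any probability measure $P$ on $G$ of finite second moment (i.e. $\sum_{g\in G}P(g)|g|^2<+\infty$), there are positive constants $K',K'',L'',K''',L'''$ such that for all $n$: - $\mathbb E|P^{(n)}|\le K'n^{1/(2-\nu)}$; - $H(P^{(n)})\le L''+K''n^{\nu/(2-\nu)}$; - $P^{(2n)}(e)\ge\exp\big(-H(P^{(n)})\big)\ge L'''\exp\big(-K'''n^{\nu/(2-\nu)}\big)$. In particular, $$\underline\beta\le\overline\beta\le\frac{1}{2-\overline\nu}\qquad\text{and}\qquad\overline\gamma\le\overline\eta\le\overline\beta\,\overline\nu\le\frac{\overline\nu}{2-\overline\nu}.$$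
   Context: $e$ is the identity element of $G$, $P^{(n)}$ is the $n$-fold convolution of $P$ with itself, $\mathbb E|P^{(n)}|=\sum_{g\in G}|g|P^{(n)}(g)$, and $H(P^{(n)})=-\sum_{g\in G}P^{(n)}(g)\ln P^{(n)}(g)$. For a function $f$ with non-negative values put $$\overline\phi(f)=\inf\{c\in[0,1]:\exists K>0,L\in\mathbb R\text{ with }f(n)\le L+Kn^c\text{ for all }n\},$$ $$\underline\phi(f)=\sup\{c\in[0,1]:\exists K>0,L\in\mathbb R\text{ with }f(n)\ge L+Kn^c\text{ for all }n\}.$$ Then $\overline\beta=\overline\phi(f)$ and $\underline\beta=\underline\phi(f)$ for $f(n)=\mathbb E|P^{(n)}|$; $\overline\eta=\overline\phi(f)$ for $f(n)=H(P^{(n)})$; $\overline\nu=\overline\phi(f)$ for $f(n)=\ln|B_n|$; and $\overline\gamma=\overline\phi(f)$ for $f(n)=-\ln P^{(n)}(e)$.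
   Formalization: P is assumed symmetric, P(g^{-1})=P(g): without this the claim fails, e.g. for the point mass at a generator of Z^3. In the definition of γ̄, times n with P^{(n)}(e)=0, where -ln P^{(n)}(e) is infinite, are given the value 0. *)

theory Defs
  imports
    "HOL-Algebra.Generated_Groups"
    "HOL-Analysis.Infinite_Sum"
    "HOL-Probability.Probability_Mass_Function"
    "HOL-Library.Landau_Symbols"
begin

definition symmetric_generating_set :: "('a, 'b) monoid_scheme \<Rightarrow> 'a set \<Rightarrow> bool" where
  "symmetric_generating_set G S \<longleftrightarrow>
     S \<subseteq> carrier G \<and> (\<forall>s\<in>S. inv\<^bsub>G\<^esub> s \<in> S) \<and> generate G S = carrier G"

definition word_length :: "('a, 'b) monoid_scheme \<Rightarrow> 'a set \<Rightarrow> 'a \<Rightarrow> nat" where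
  "word_length G S g =
     (LEAST n. \<exists>ws. set ws \<subseteq> S \<and> length ws = n \<and> foldr (\<lambda>x y. x \<otimes>\<^bsub>G\<^esub> y) ws \<one>\<^bsub>G\<^esub> = g)"

definition word_ball :: "('a, 'b) monoid_scheme \<Rightarrow> 'a set \<Rightarrow> nat \<Rightarrow> 'a set" where
  "word_ball G S n = {g \<in> carrier G. word_length G S g \<le> n}"

text \<open>A probability measure on \<open>G\<close> is a \<open>pmf\<close> on the underlying type whose support is
  contained in \<open>carrier G\<close>.\<close>

definition group_convolution :: "('a, 'b) monoid_scheme \<Rightarrow> 'a pmf \<Rightarrow> 'a pmf \<Rightarrow> 'a pmf" where
  "group_convolution G P Q = bind_pmf P (\<lambda>x. map_pmf (\<lambda>y. x \<otimes>\<^bsub>G\<^esub> y) Q)"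

primrec conv_power :: "('a, 'b) monoid_scheme \<Rightarrow> 'a pmf \<Rightarrow> nat \<Rightarrow> 'a pmf" where
  "conv_power G P 0 = return_pmf \<one>\<^bsub>G\<^esub>"
| "conv_power G P (Suc n) = group_convolution G P (conv_power G P n)"

definition symmetric_measure :: "('a, 'b) monoid_scheme \<Rightarrow> 'a pmf \<Rightarrow> bool" where
  "symmetric_measure G P \<longleftrightarrow> (\<forall>g\<in>carrier G. pmf P (inv\<^bsub>G\<^esub> g) = pmf P g)"

definition finite_second_moment :: "('a, 'b) monoid_scheme \<Rightarrow> 'a set \<Rightarrow> 'a pmf \<Rightarrow> bool" where
  "finite_second_moment G S P \<longleftrightarrow>
     (\<lambda>g. pmf P g * (real (word_length G S g))\<^sup>2) summable_on carrier G"

text \<open>Both sums below have terms of constant sign, and \<open>infsum\<close> is \<open>0\<close> when such a series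
  diverges; a bound on them is only meaningful together with the corresponding summability.
  The convention \<open>0 ln 0 = 0\<close> of the entropy is automatic.\<close>

definition finite_mean_length :: "('a, 'b) monoid_scheme \<Rightarrow> 'a set \<Rightarrow> 'a pmf \<Rightarrow> bool" where
  "finite_mean_length G S Q \<longleftrightarrow>
     (\<lambda>g. real (word_length G S g) * pmf Q g) summable_on carrier G"

definition mean_length :: "('a, 'b) monoid_scheme \<Rightarrow> 'a set \<Rightarrow> 'a pmf \<Rightarrow> real" where
  "mean_length G S Q = (\<Sum>\<^sub>\<infinity>g\<in>carrier G. real (word_length G S g) * pmf Q g)"

definition finite_entropy :: "('a, 'b) monoid_scheme \<Rightarrow> 'a pmf \<Rightarrow> bool" where
  "finite_entropy G Q \<longleftrightarrow> (\<lambda>g. pmf Q g * ln (pmf Q g)) summable_on carrier G"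

definition shannon_entropy :: "('a, 'b) monoid_scheme \<Rightarrow> 'a pmf \<Rightarrow> real" where
  "shannon_entropy G Q = - (\<Sum>\<^sub>\<infinity>g\<in>carrier G. pmf Q g * ln (pmf Q g))"

text \<open>In HOL \<open>0 powr 0 = 0\<close>; since the additive constant \<open>L\<close> is free, the value at
  \<open>n = 0\<close> does not affect the exponents.\<close>

definition upper_exponent :: "(nat \<Rightarrow> real) \<Rightarrow> real" where
  "upper_exponent f = Inf {c \<in> {0..1}. \<exists>K L. K > 0 \<and> (\<forall>n. f n \<le> L + K * real n powr c)}"

definition lower_exponent :: "(nat \<Rightarrow> real) \<Rightarrow> real" where
  "lower_exponent f = Sup {c \<in> {0..1}. \<exists>K L. K > 0 \<and> (\<forall>n. f n \<ge> L + K * real n powr c)}"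

definition beta_upper :: "('a, 'b) monoid_scheme \<Rightarrow> 'a set \<Rightarrow> 'a pmf \<Rightarrow> real" where
  "beta_upper G S P = upper_exponent (\<lambda>n. mean_length G S (conv_power G P n))"

definition beta_lower :: "('a, 'b) monoid_scheme \<Rightarrow> 'a set \<Rightarrow> 'a pmf \<Rightarrow> real" where
  "beta_lower G S P = lower_exponent (\<lambda>n. mean_length G S (conv_power G P n))"

definition eta_upper :: "('a, 'b) monoid_scheme \<Rightarrow> 'a pmf \<Rightarrow> real" where
  "eta_upper G P = upper_exponent (\<lambda>n. shannon_entropy G (conv_power G P n))"

definition nu_upper :: "('a, 'b) monoid_scheme \<Rightarrow> 'a set \<Rightarrow> real" where
  "nu_upper G S = upper_exponent (\<lambda>n. ln (real (card (word_ball G S n))))"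

text \<open>The walk may be unable to return at some times (at all odd times for a bipartite Cayley
  graph), where \<open>- ln 0\<close> would be infinite. The value \<open>0\<close> there makes the upper exponent
  range over the times of possible return only.\<close>

definition gamma_upper :: "('a, 'b) monoid_scheme \<Rightarrow> 'a pmf \<Rightarrow> real" where
  "gamma_upper G P = upper_exponent (\<lambda>n.
     let p = pmf (conv_power G P n) \<one>\<^bsub>G\<^esub> in if p = 0 then 0 else - ln p)"

end

theory Submission
  imports
    Defs
    "HOL-Probability.Product_PMF"
    "HOL-Real_Asymp.Real_Asymp"
begin

text \<open>
  Let \<open>L n\<close> and \<open>H n\<close> be the mean length and the entropy of the \<open>n\<close>-th convolution power of \<open>P\<close>. The
  proof plays two inequalities between them against each other.

  The first one holds on every group: the mean length can grow only at the expense of entropy. The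
  entropy gained in one step is the average relative entropy of a translate of the law at time \<open>n\<close> with
  respect to the law at time \<open>n + 1\<close> (\<open>convolution_entropy_pairs\<close>), and relative entropy dominates the squared
  Hellinger distance. On the other hand the symmetry of \<open>P\<close> expresses \<open>L (n + 2) - L n\<close> by the difference
  of the same two laws, integrated against increments of the length that are bounded by the length of
  one step. Hence, for every weight \<open>c > 0\<close>,
  \<open>L (n + 2) - L n \<le> c / 2 * (H (n + 1) - H n) + 2 * M / c\<close>
  with \<open>M\<close> the second moment of \<open>P\<close> (\<open>mean_length_increment_le\<close>). Summed over time this gives
  \<open>L n \<le> L 1 + c / 2 * H n + M * n / c\<close> (\<open>mean_length_le_entropy\<close>).

  The second one expresses the volume bound: when balls have at most \<open>B * exp (K * n powr d)\<close> elements, a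
  measure of mean length \<open>l\<close> has entropy at most of order \<open>1 + l powr d\<close> (\<open>entropy_le_mean_length\<close>).

  Inserting the second inequality into the first with \<open>c\<close> of order \<open>L n powr (1 - d)\<close> leaves
  \<open>L n powr (2 - d)\<close> at most of order \<open>n\<close> (\<open>mean_length_walk_le\<close>), and the entropy bound follows. The return
  probability is the collision probability of two independent copies of the walk, hence at least
  \<open>exp (- H n)\<close> by Jensen's inequality (\<open>return_probability_ge_entropy\<close>). The inequalities between exponents come from
  applying these bounds with every admissible volume exponent and passing to infima.
\<close>

section \<open>Sums over products\<close>

lemma has_sum_product_nonnegI:
  fixes f :: "'a \<times> 'b \<Rightarrow> real"
  assumes "\<And>x. x \<in> A \<Longrightarrow> ((\<lambda>y. f (x, y)) has_sum g x) B"
    and "(g has_sum s) A"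
    and "\<And>x y. x \<in> A \<Longrightarrow> y \<in> B \<Longrightarrow> 0 \<le> f (x, y)"
  shows "(f has_sum s) (A \<times> B)"
proof (rule has_sum_SigmaI[where g = g])
  show "f summable_on A \<times> B"
    using assms by (intro summable_on_SigmaI[where g = g]) (auto simp: summable_on_def)
qed (use assms in auto)

lemma has_sum_product_nonnegI':
  fixes f :: "'a \<times> 'b \<Rightarrow> real"
  assumes "\<And>y. y \<in> B \<Longrightarrow> ((\<lambda>x. f (x, y)) has_sum g y) A"
    and "(g has_sum s) B"
    and "\<And>x y. x \<in> A \<Longrightarrow> y \<in> B \<Longrightarrow> 0 \<le> f (x, y)"
  shows "(f has_sum s) (A \<times> B)"
  unfolding has_sum_swap[of f]
  by (rule has_sum_product_nonnegI[where g = g]) (use assms in auto)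

lemma has_sum_difference:
  fixes f g :: "'a \<Rightarrow> real"
  assumes "(f has_sum a) A" "(g has_sum b) A"
  shows "((\<lambda>x. f x - g x) has_sum a - b) A"
  using has_sum_add[OF assms(1) has_sum_uminusI[OF assms(2)]] by simp

lemma has_sum_product_mult_nonneg:
  fixes f :: "'a \<Rightarrow> real" and g :: "'b \<Rightarrow> real"
  assumes "(f has_sum a) A" "(g has_sum b) B"
    and "\<And>x. x \<in> A \<Longrightarrow> 0 \<le> f x" "\<And>y. y \<in> B \<Longrightarrow> 0 \<le> g y"
  shows "((\<lambda>(x, y). f x * g y) has_sum a * b) (A \<times> B)"
  by (rule has_sum_product_nonnegI[where g = "\<lambda>x. f x * b"])
    (use assms in \<open>auto intro!: has_sum_cmult_right has_sum_cmult_left\<close>)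

section \<open>Convolution of probability measures on a group\<close>

lemma pmf_has_sum_one:
  assumes "set_pmf Q \<subseteq> A"
  shows "(pmf Q has_sum 1) A"
proof -
  have summable: "pmf Q summable_on A"
    by (rule abs_summable_summable, subst abs_summable_equivalent, rule pmf_abs_summable)
  moreover have "infsum (pmf Q) A = 1"
    using infsetsum_infsum[of "pmf Q" A] infsetsum_pmf_eq_1[OF assms]
    by (simp add: pmf_abs_summable)
  ultimately show ?thesis
    using has_sum_infsum[OF summable] by simp
qed

text \<open>The range restriction on \<open>f\<close> makes the series converge; the lemma is applied to the values
  of a probability mass function.\<close>

lemma expectation_pmf_has_sum:
  fixes f :: "'a \<Rightarrow> real"
  assumes "set_pmf Q \<subseteq> A" and "\<And>x. 0 \<le> f x" and "\<And>x. f x \<le> 1"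
  shows "((\<lambda>x. pmf Q x * f x) has_sum measure_pmf.expectation Q f) A"
proof -
  have "(\<lambda>x. pmf Q x * f x) summable_on A"
    by (rule summable_on_comparison_test[where f = "pmf Q"])
      (use assms pmf_has_sum_one[OF assms(1)] in \<open>auto simp: summable_on_def mult_left_le\<close>)
  then have *: "Infinite_Set_Sum.abs_summable_on (\<lambda>x. pmf Q x * f x) A"
    using assms(2) by (subst abs_summable_equivalent[symmetric]) (simp add: abs_mult)
  have "measure_pmf.expectation Q f = infsetsum (\<lambda>x. pmf Q x * f x) UNIV"
    by (simp add: pmf_expectation_eq_infsetsum)
  also have "\<dots> = infsetsum (\<lambda>x. pmf Q x * f x) A"
    by (rule infsetsum_cong_neutral) (use assms(1) in \<open>auto simp: set_pmf_iff\<close>)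
  also have "\<dots> = infsum (\<lambda>x. pmf Q x * f x) A"
    by (rule infsetsum_infsum[OF *])
  finally show ?thesis
    using \<open>(\<lambda>x. pmf Q x * f x) summable_on A\<close> by (simp add: has_sum_infsum)
qed

context group
begin

lemma inv_mult_cancel_left:
  assumes "x \<in> carrier G" "y \<in> carrier G"
  shows "inv x \<otimes> (x \<otimes> y) = y" and "x \<otimes> (inv x \<otimes> y) = y"
  using assms by (simp_all flip: m_assoc)

lemma bij_betw_left_translation:
  assumes "x \<in> carrier G"
  shows "bij_betw (\<lambda>g. x \<otimes> g) (carrier G) (carrier G)"
  by (rule bij_betw_byWitness[where f' = "\<lambda>g. inv x \<otimes> g"]) (use assms in \<open>auto simp: inv_mult_cancel_left\<close>)

lemma bij_betw_inverse: "bij_betw (\<lambda>g. inv g) (carrier G) (carrier G)"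
  by (rule bij_betw_byWitness[where f' = "\<lambda>g. inv g"]) auto

lemma pmf_left_translation:
  assumes "x \<in> carrier G" "g \<in> carrier G" "set_pmf Q \<subseteq> carrier G"
  shows "pmf (map_pmf (\<lambda>y. x \<otimes> y) Q) g = pmf Q (inv x \<otimes> g)"
proof -
  have "x \<otimes> y = g \<longleftrightarrow> y = inv x \<otimes> g" if "y \<in> set_pmf Q" for y
  proof -
    have "y \<in> carrier G" using assms(3) that by blast
    then show ?thesis using assms(1,2) by (metis inv_mult_cancel_left)
  qed
  then have "(\<lambda>y. x \<otimes> y) -` {g} \<inter> set_pmf Q = {inv x \<otimes> g} \<inter> set_pmf Q"
    by blast
  then have "measure Q ((\<lambda>y. x \<otimes> y) -` {g}) = measure Q {inv x \<otimes> g}"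
    by (metis measure_Int_set_pmf)
  then show ?thesis
    by (simp add: pmf_map measure_pmf_single)
qed

lemma set_pmf_group_convolution:
  assumes "set_pmf P \<subseteq> carrier G" "set_pmf Q \<subseteq> carrier G"
  shows "set_pmf (group_convolution G P Q) \<subseteq> carrier G"
  using assms by (auto simp: group_convolution_def)

lemma pmf_group_convolution_has_sum:
  assumes "set_pmf P \<subseteq> carrier G" "set_pmf Q \<subseteq> carrier G" "g \<in> carrier G"
  shows "((\<lambda>x. pmf P x * pmf Q (inv x \<otimes> g)) has_sum pmf (group_convolution G P Q) g) (carrier G)"
proof -
  have "pmf (group_convolution G P Q) g
      = measure_pmf.expectation P (\<lambda>x. pmf (map_pmf (\<lambda>y. x \<otimes> y) Q) g)"
    by (simp add: group_convolution_def pmf_bind)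
  then have "((\<lambda>x. pmf P x * pmf (map_pmf (\<lambda>y. x \<otimes> y) Q) g)
      has_sum pmf (group_convolution G P Q) g) (carrier G)"
    using expectation_pmf_has_sum[OF assms(1)] by (metis (no_types) pmf_le_1 pmf_nonneg)
  then show ?thesis
    using assms by (subst has_sum_cong) (auto simp: pmf_left_translation)
qed

text \<open>Keeping a single factorization of \<open>x \<otimes> y\<close> already gives this bound. For a step \<open>x\<close> of
  positive probability it excludes that \<open>Q\<close> charges \<open>k\<close> while \<open>P * Q\<close> misses \<open>x \<otimes> k\<close>, where the relative
  entropies below would be infinite; and it transports return probabilities from one time to a later one.\<close>

lemma group_convolution_mass_ge:
  assumes "set_pmf P \<subseteq> carrier G" "set_pmf Q \<subseteq> carrier G" "x \<in> carrier G" "y \<in> carrier G"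
  shows "pmf P x * pmf Q y \<le> pmf (group_convolution G P Q) (x \<otimes> y)"
proof -
  have "((\<lambda>z. pmf P z * pmf Q (inv z \<otimes> (x \<otimes> y))) has_sum pmf P x * pmf Q y) {x}"
    using assms by (simp add: inv_mult_cancel_left has_sum_finite_iff)
  moreover have "((\<lambda>z. pmf P z * pmf Q (inv z \<otimes> (x \<otimes> y)))
      has_sum pmf (group_convolution G P Q) (x \<otimes> y)) (carrier G)"
    using assms by (intro pmf_group_convolution_has_sum) auto
  ultimately show ?thesis
    by (rule has_sum_mono2) (use assms in auto)
qed

text \<open>All double sums of the proof are indexed by a step \<open>x\<close> and a position \<open>k\<close> before the step. This
  change of variables passes to the position \<open>x \<otimes> k\<close> after the step.\<close>

lemma pair_shear_has_sum:
  fixes f :: "'a \<times> 'a \<Rightarrow> real"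
  shows "((\<lambda>(x, k). f (x, x \<otimes> k)) has_sum s) (carrier G \<times> carrier G)
     \<longleftrightarrow> (f has_sum s) (carrier G \<times> carrier G)"
proof -
  have "bij_betw (\<lambda>(x, k). (x, x \<otimes> k)) (carrier G \<times> carrier G) (carrier G \<times> carrier G)"
    by (rule bij_betw_byWitness[where f' = "\<lambda>(x, k). (x, inv x \<otimes> k)"])
      (auto simp: inv_mult_cancel_left)
  from has_sum_reindex_bij_betw[OF this, of f s] show ?thesis
    by (simp add: case_prod_unfold)
qed

text \<open>The equivalence serves in both directions: from right to left it evaluates a double sum whose
  single sum is known, from left to right it proves that a moment of \<open>P * Q\<close> is finite.\<close>

lemma convolution_has_sum_iff:
  fixes f :: "'a \<Rightarrow> real"
  assumes "set_pmf P \<subseteq> carrier G" "set_pmf Q \<subseteq> carrier G"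
    and "\<And>g. g \<in> carrier G \<Longrightarrow> 0 \<le> f g"
  shows "((\<lambda>(x, k). pmf P x * pmf Q k * f (x \<otimes> k)) has_sum s) (carrier G \<times> carrier G)
     \<longleftrightarrow> ((\<lambda>g. pmf (group_convolution G P Q) g * f g) has_sum s) (carrier G)"
    (is "?pairs \<longleftrightarrow> ?single")
proof -
  define F where "F = (\<lambda>(x, g). pmf P x * pmf Q (inv x \<otimes> g) * f g)"
  have "?pairs \<longleftrightarrow> ((\<lambda>(x, k). F (x, x \<otimes> k)) has_sum s) (carrier G \<times> carrier G)"
    by (rule has_sum_cong) (auto simp: F_def inv_mult_cancel_left)
  also have "\<dots> \<longleftrightarrow> (F has_sum s) (carrier G \<times> carrier G)"
    by (rule pair_shear_has_sum)
  finally have pairs: "?pairs \<longleftrightarrow> (F has_sum s) (carrier G \<times> carrier G)" .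
  have inner: "((\<lambda>x. F (x, g)) has_sum pmf (group_convolution G P Q) g * f g) (carrier G)"
    if "g \<in> carrier G" for g
    unfolding F_def using has_sum_cmult_left[OF pmf_group_convolution_has_sum[OF assms(1,2) that]]
    by simp
  show ?thesis
  proof
    assume ?pairs
    then have "((\<lambda>(g, x). F (x, g)) has_sum s) (carrier G \<times> carrier G)"
      unfolding pairs by (subst (asm) has_sum_swap)
    from has_sum_SigmaD[OF this] show ?single
      using inner by auto
  next
    assume ?single
    then show ?pairs
      unfolding pairs using inner assms(3)
      by (intro has_sum_product_nonnegI') (auto simp: F_def)
  qed
qed

lemma group_convolution_assoc:
  assumes "set_pmf P \<subseteq> carrier G" "set_pmf Q \<subseteq> carrier G" "set_pmf R \<subseteq> carrier G"
  shows "group_convolution G (group_convolution G P Q) R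
       = group_convolution G P (group_convolution G Q R)"
proof -
  have "map_pmf (\<lambda>z. x \<otimes> y \<otimes> z) R = map_pmf (\<lambda>z. x \<otimes> (y \<otimes> z)) R"
    if "x \<in> set_pmf P" "y \<in> set_pmf Q" for x y
    by (rule map_pmf_cong) (use assms that in \<open>auto simp: m_assoc subset_iff\<close>)
  then show ?thesis
    by (simp add: group_convolution_def bind_assoc_pmf bind_map_pmf map_bind_pmf map_pmf_comp
        cong: bind_pmf_cong)
qed

lemma set_pmf_conv_power:
  assumes "set_pmf P \<subseteq> carrier G"
  shows "set_pmf (conv_power G P n) \<subseteq> carrier G"
  by (induction n) (simp_all add: set_pmf_group_convolution assms)

lemma group_convolution_one_left:
  assumes "set_pmf P \<subseteq> carrier G"
  shows "group_convolution G (return_pmf \<one>) P = P"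
proof -
  have "map_pmf (\<lambda>y. \<one> \<otimes> y) P = map_pmf (\<lambda>y. y) P"
    by (rule map_pmf_cong) (use assms in auto)
  then show ?thesis
    by (simp add: group_convolution_def bind_return_pmf)
qed

lemma group_convolution_one_right:
  assumes "set_pmf P \<subseteq> carrier G"
  shows "group_convolution G P (return_pmf \<one>) = P"
proof -
  have "group_convolution G P (return_pmf \<one>) = bind_pmf P return_pmf"
    unfolding group_convolution_def by (rule bind_pmf_cong) (use assms in auto)
  then show ?thesis
    by (simp add: bind_return_pmf')
qed

lemma conv_power_add:
  assumes "set_pmf P \<subseteq> carrier G"
  shows "conv_power G P (m + n) = group_convolution G (conv_power G P m) (conv_power G P n)"
proof (induction m)
  case 0
  then show ?case
    by (simp add: group_convolution_one_left set_pmf_conv_power assms)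
next
  case (Suc m)
  then show ?case
    by (simp add: group_convolution_assoc set_pmf_conv_power assms)
qed

lemma conv_power_one:
  assumes "set_pmf P \<subseteq> carrier G"
  shows "conv_power G P 1 = P"
  using assms by (simp add: group_convolution_one_right)

text \<open>Inversion reverses the order of the factors, so the image of \<open>P * Q\<close> under it is \<open>Q * P\<close>.\<close>

lemma symmetric_measure_group_convolution:
  assumes "set_pmf P \<subseteq> carrier G" "set_pmf Q \<subseteq> carrier G"
    and "symmetric_measure G P" "symmetric_measure G Q"
    and comm: "group_convolution G P Q = group_convolution G Q P"
  shows "symmetric_measure G (group_convolution G P Q)"
  unfolding symmetric_measure_def
proof
  fix g assume g: "g \<in> carrier G"
  have "((\<lambda>x. pmf P x * pmf Q (inv x \<otimes> inv g)) has_sum pmf (group_convolution G P Q) (inv g)) (carrier G)"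
    using assms g by (intro pmf_group_convolution_has_sum) auto
  also have "?this \<longleftrightarrow> ((\<lambda>x. pmf P x * pmf Q (g \<otimes> x)) has_sum pmf (group_convolution G P Q) (inv g)) (carrier G)"
    using g assms(4)
    by (intro has_sum_cong) (auto simp: symmetric_measure_def simp flip: inv_mult_group)
  also have "\<dots> \<longleftrightarrow> ((\<lambda>x. pmf P (inv x) * pmf Q (g \<otimes> inv x)) has_sum pmf (group_convolution G P Q) (inv g)) (carrier G)"
    using has_sum_reindex_bij_betw[OF bij_betw_inverse] by (rule sym)
  finally have 1: "((\<lambda>x. pmf P (inv x) * pmf Q (g \<otimes> inv x)) has_sum pmf (group_convolution G P Q) (inv g)) (carrier G)" .
  have "((\<lambda>x. pmf Q x * pmf P (inv x \<otimes> g)) has_sum pmf (group_convolution G Q P) g) (carrier G)"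
    using assms g by (intro pmf_group_convolution_has_sum) auto
  also have "?this \<longleftrightarrow> ((\<lambda>x. pmf Q (g \<otimes> x) * pmf P (inv (g \<otimes> x) \<otimes> g)) has_sum pmf (group_convolution G Q P) g) (carrier G)"
    using has_sum_reindex_bij_betw[OF bij_betw_left_translation[OF g]] by (rule sym)
  also have "\<dots> \<longleftrightarrow> ((\<lambda>x. pmf Q (g \<otimes> x) * pmf P (inv x)) has_sum pmf (group_convolution G Q P) g) (carrier G)"
    using g by (intro has_sum_cong) (auto simp: inv_mult_group m_assoc)
  also have "\<dots> \<longleftrightarrow> ((\<lambda>x. pmf Q (g \<otimes> inv x) * pmf P (inv (inv x))) has_sum pmf (group_convolution G Q P) g) (carrier G)"
    using has_sum_reindex_bij_betw[OF bij_betw_inverse] by (rule sym)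
  also have "\<dots> \<longleftrightarrow> ((\<lambda>x. pmf P (inv x) * pmf Q (g \<otimes> inv x)) has_sum pmf (group_convolution G P Q) g) (carrier G)"
    using assms(3) by (unfold comm, intro has_sum_cong) (auto simp: symmetric_measure_def)
  finally show "pmf (group_convolution G P Q) (inv g) = pmf (group_convolution G P Q) g"
    using 1 has_sum_unique by blast
qed

lemma symmetric_measure_conv_power:
  assumes "set_pmf P \<subseteq> carrier G" "symmetric_measure G P"
  shows "symmetric_measure G (conv_power G P n)"
proof (induction n)
  case 0
  have "\<one> = inv g \<longleftrightarrow> \<one> = g" if "g \<in> carrier G" for g
    using inv_eq_1_iff[OF that] by (simp only: eq_commute[of \<one>])
  then show ?case
    by (simp add: symmetric_measure_def indicator_def)
next
  case (Suc n)
  have "group_convolution G P (conv_power G P n) = group_convolution G (conv_power G P n) P"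
    using conv_power_add[OF assms(1), of n 1] conv_power_one[OF assms(1)] by simp
  then show ?case
    using symmetric_measure_group_convolution assms Suc set_pmf_conv_power by simp
qed

end

section \<open>The word length\<close>

locale word_metric_group = group G for G (structure) +
  fixes S :: "'a set"
  assumes finite_generators: "finite S"
    and generators: "symmetric_generating_set G S"
begin

lemma generators_closed: "S \<subseteq> carrier G"
  and generators_inv: "s \<in> S \<Longrightarrow> inv s \<in> S"
  using generators by (auto simp: symmetric_generating_set_def)

lemma word_product_closed: "set ws \<subseteq> S \<Longrightarrow> foldr (\<lambda>x y. x \<otimes> y) ws \<one> \<in> carrier G"
  using generators_closed by (induction ws) auto

lemma word_product_append:
  assumes "set vs \<subseteq> S" "set ws \<subseteq> S"
  shows "foldr (\<lambda>x y. x \<otimes> y) (vs @ ws) \<one> = foldr (\<lambda>x y. x \<otimes> y) vs \<one> \<otimes> foldr (\<lambda>x y. x \<otimes> y) ws \<one>"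
  using assms
proof (induction vs)
  case Nil
  then show ?case by (simp add: word_product_closed)
next
  case (Cons v vs)
  then have "v \<in> carrier G" using generators_closed by auto
  with Cons show ?case by (simp add: word_product_closed m_assoc del: foldr_append)
qed

lemma word_product_inverse:
  assumes "set ws \<subseteq> S"
  shows "foldr (\<lambda>x y. x \<otimes> y) (rev (map (\<lambda>s. inv s) ws)) \<one> = inv (foldr (\<lambda>x y. x \<otimes> y) ws \<one>)"
  using assms
proof (induction ws)
  case (Cons w ws)
  then have w: "w \<in> carrier G" "inv w \<in> S" using generators_closed generators_inv by auto
  have "foldr (\<lambda>x y. x \<otimes> y) (rev (map (\<lambda>s. inv s) ws) @ [inv w]) \<one>
     = foldr (\<lambda>x y. x \<otimes> y) (rev (map (\<lambda>s. inv s) ws)) \<one> \<otimes> foldr (\<lambda>x y. x \<otimes> y) [inv w] \<one>"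
    by (rule word_product_append) (use Cons.prems w generators_inv in auto)
  with Cons w show ?case
    by (simp add: word_product_closed inv_mult_group del: foldr_append)
qed auto

lemma word_length_le:
  assumes "set ws \<subseteq> S" "foldr (\<lambda>x y. x \<otimes> y) ws \<one> = g"
  shows "word_length G S g \<le> length ws"
  unfolding word_length_def by (rule Least_le) (use assms in blast)

lemma exists_word:
  assumes "g \<in> carrier G"
  shows "\<exists>ws. set ws \<subseteq> S \<and> foldr (\<lambda>x y. x \<otimes> y) ws \<one> = g"
proof -
  have "g \<in> generate G S"
    using assms generators by (simp add: symmetric_generating_set_def)
  then show ?thesis
  proof (induction rule: generate.induct)
    case one
    show ?case by (rule exI[of _ "[]"]) simp
  next
    case (incl h)
    then show ?case using generators_closed by (intro exI[of _ "[h]"]) auto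
  next
    case (inv h)
    then show ?case using generators_closed generators_inv by (intro exI[of _ "[inv h]"]) auto
  next
    case (eng h1 h2)
    then obtain vs ws where "set vs \<subseteq> S" "foldr (\<lambda>x y. x \<otimes> y) vs \<one> = h1"
      "set ws \<subseteq> S" "foldr (\<lambda>x y. x \<otimes> y) ws \<one> = h2" by blast
    then show ?case using word_product_append
      by (intro exI[of _ "vs @ ws"]) (auto simp del: foldr_append)
  qed
qed

lemma shortest_word:
  assumes "g \<in> carrier G"
  obtains ws where "set ws \<subseteq> S" "length ws = word_length G S g" "foldr (\<lambda>x y. x \<otimes> y) ws \<one> = g"
proof -
  have "\<exists>n ws. set ws \<subseteq> S \<and> length ws = n \<and> foldr (\<lambda>x y. x \<otimes> y) ws \<one> = g"
    using exists_word[OF assms] by blast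
  from LeastI_ex[OF this] show ?thesis
    unfolding word_length_def[symmetric] using that by blast
qed

lemma word_length_one: "word_length G S \<one> = 0"
  using word_length_le[of "[]" \<one>] by simp

lemma word_length_mult_le:
  assumes "x \<in> carrier G" "y \<in> carrier G"
  shows "word_length G S (x \<otimes> y) \<le> word_length G S x + word_length G S y"
proof -
  obtain vs where vs: "set vs \<subseteq> S" "length vs = word_length G S x" "foldr (\<lambda>x y. x \<otimes> y) vs \<one> = x"
    using shortest_word assms(1) .
  obtain ws where ws: "set ws \<subseteq> S" "length ws = word_length G S y" "foldr (\<lambda>x y. x \<otimes> y) ws \<one> = y"
    using shortest_word assms(2) .
  show ?thesis
    using word_length_le[of "vs @ ws" "x \<otimes> y"] word_product_append[OF vs(1) ws(1)] vs ws
    by (simp del: foldr_append)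
qed

lemma word_length_inv_le:
  assumes "x \<in> carrier G"
  shows "word_length G S (inv x) \<le> word_length G S x"
proof -
  obtain vs where vs: "set vs \<subseteq> S" "length vs = word_length G S x" "foldr (\<lambda>x y. x \<otimes> y) vs \<one> = x"
    using shortest_word assms(1) .
  have "set (rev (map (\<lambda>s. inv s) vs)) \<subseteq> S"
    using vs generators_inv by auto
  from word_length_le[OF this word_product_inverse[OF vs(1)]] vs show ?thesis
    by simp
qed

text \<open>A step \<open>x\<close> on the left moves the length by at most the length of \<open>x\<close>: besides the triangle
  inequality this uses that the inverse of \<open>x\<close> is not longer than \<open>x\<close>.\<close>

lemma word_length_translation:
  assumes "x \<in> carrier G" "k \<in> carrier G"
  shows "\<bar>real (word_length G S (x \<otimes> k)) - real (word_length G S k)\<bar> \<le> real (word_length G S x)"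
proof -
  have "word_length G S (inv x \<otimes> (x \<otimes> k)) \<le> word_length G S x + word_length G S (x \<otimes> k)"
    using word_length_mult_le[of "inv x" "x \<otimes> k"] word_length_inv_le[of x] assms by simp
  then have "word_length G S k \<le> word_length G S x + word_length G S (x \<otimes> k)"
    using assms by (simp add: inv_mult_cancel_left)
  with word_length_mult_le[OF assms] show ?thesis by linarith
qed

lemma finite_word_ball: "finite (word_ball G S n)"
proof (rule finite_subset)
  show "word_ball G S n \<subseteq> (\<lambda>ws. foldr (\<lambda>x y. x \<otimes> y) ws \<one>) ` {ws. set ws \<subseteq> S \<and> length ws \<le> n}"
    unfolding word_ball_def by (auto elim!: shortest_word intro!: image_eqI[OF sym])
  show "finite ((\<lambda>ws. foldr (\<lambda>x y. x \<otimes> y) ws \<one>) ` {ws. set ws \<subseteq> S \<and> length ws \<le> n})"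
    using finite_generators by (simp add: finite_lists_length_le)
qed

lemma card_word_ball_ge_one: "1 \<le> card (word_ball G S n)"
proof -
  have "\<one> \<in> word_ball G S n" by (simp add: word_ball_def word_length_one)
  then show ?thesis using finite_word_ball card_gt_0_iff by (metis One_nat_def Suc_leI empty_iff)
qed

end

section \<open>Pointwise entropy inequalities\<close>

text \<open>The right-hand side is the pointwise relative entropy of \<open>s\<close> with respect to \<open>r\<close>, corrected by
  \<open>r - s\<close> so that it is non-negative term by term. The bound is \<open>ln y \<le> y - 1\<close> at
  \<open>y = sqrt r / sqrt s\<close>.\<close>

lemma relative_entropy_ge_hellinger:
  fixes s r :: real
  assumes "0 \<le> s" "0 \<le> r" "r = 0 \<Longrightarrow> s = 0"
  shows "(sqrt s - sqrt r)\<^sup>2 \<le> s * ln s - s * ln r - s + r"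
proof (cases "s = 0")
  case True
  then show ?thesis using assms by simp
next
  case False
  with assms have pos: "s > 0" "r > 0" by (auto simp: less_le)
  define y where "y = sqrt r / sqrt s"
  have y: "y > 0" using pos by (simp add: y_def)
  have "s * y = sqrt s * sqrt r"
    using pos by (simp add: y_def field_simps flip: power2_eq_square)
  moreover have "ln r - ln s = 2 * ln y"
    using pos by (simp add: y_def ln_div ln_sqrt)
  moreover have "s * ln y \<le> s * (y - 1)"
    using pos y by (intro mult_left_mono ln_le_minus_one) auto
  moreover have "s * ln s - s * ln r = - (s * (ln r - ln s))"
    by (simp add: algebra_simps)
  moreover have "(sqrt s - sqrt r)\<^sup>2 = s + r - 2 * (sqrt s * sqrt r)"
    using pos by (simp add: power2_diff)
  ultimately show ?thesis
    by (simp add: algebra_simps)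
qed

text \<open>Factor \<open>s - r\<close> through square roots and split the product by the inequality of arithmetic and
  geometric means with weight \<open>c\<close>. Here \<open>u\<close> will be the length of a step. Using a free weight \<open>c\<close>
  instead of the Cauchy-Schwarz inequality keeps the bound linear in the entropy, so that it can be
  summed over time before \<open>c\<close> is chosen.\<close>

lemma difference_le_relative_entropy:
  fixes s r u c :: real
  assumes "0 \<le> s" "0 \<le> r" "r = 0 \<Longrightarrow> s = 0" "0 < c"
  shows "u * \<bar>s - r\<bar> \<le> c / 2 * (s * ln s - s * ln r - s + r) + u\<^sup>2 * (s + r) / c"
proof -
  define a where "a = \<bar>sqrt s - sqrt r\<bar>"
  define b where "b = sqrt s + sqrt r"
  have "(sqrt s - sqrt r) * (sqrt s + sqrt r) = s - r"
    using assms by (simp add: algebra_simps)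
  then have ab: "\<bar>s - r\<bar> = a * b"
    using assms by (simp add: a_def b_def flip: abs_mult)
      (metis abs_mult abs_of_nonneg add_nonneg_nonneg real_sqrt_ge_zero)
  have "b\<^sup>2 + a\<^sup>2 = 2 * (s + r)"
    using assms by (simp add: a_def b_def power2_sum power2_diff)
  then have b2: "b\<^sup>2 \<le> 2 * (s + r)"
    using zero_le_power2[of a] by linarith
  have "0 \<le> (c * a - u * b)\<^sup>2 / (2 * c)"
    using assms by simp
  also have "\<dots> = c / 2 * a\<^sup>2 + u\<^sup>2 * b\<^sup>2 / (2 * c) - u * (a * b)"
    using assms by (simp add: power2_eq_square field_simps)
  finally have "u * (a * b) \<le> c / 2 * a\<^sup>2 + u\<^sup>2 * b\<^sup>2 / (2 * c)"
    by simp
  also have "c / 2 * a\<^sup>2 \<le> c / 2 * (s * ln s - s * ln r - s + r)"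
    using relative_entropy_ge_hellinger[of s r] assms
    by (intro mult_left_mono) (auto simp: a_def)
  also have "u\<^sup>2 * b\<^sup>2 / (2 * c) \<le> u\<^sup>2 * (2 * (s + r)) / (2 * c)"
    using assms b2 by (intro divide_right_mono mult_left_mono) auto
  also have "u\<^sup>2 * (2 * (s + r)) / (2 * c) = u\<^sup>2 * (s + r) / c"
    using assms by (simp add: field_simps)
  finally show ?thesis
    unfolding ab by simp
qed

section \<open>Entropy gain under convolution\<close>

context group
begin

lemma shannon_entropy_has_sum:
  assumes "finite_entropy G Q"
  shows "((\<lambda>g. pmf Q g * ln (pmf Q g)) has_sum - shannon_entropy G Q) (carrier G)"
  using has_sum_infsum[OF assms[unfolded finite_entropy_def]]
  by (simp add: shannon_entropy_def)

lemma shannon_entropy_nonneg: "0 \<le> shannon_entropy G Q"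
proof -
  have "0 \<le> - (pmf Q g * ln (pmf Q g))" for g
    by (cases "pmf Q g = 0") (auto simp: mult_le_0_iff pmf_nonneg pmf_le_1 less_le)
  then show ?thesis
    unfolding shannon_entropy_def infsum_uminus[symmetric] by (intro infsum_nonneg)
qed

text \<open>The entropy gained by one step is the average over the step \<open>x\<close> of the relative entropy of the
  \<open>x\<close>-translate of \<open>Q\<close> with respect to \<open>R = P * Q\<close>. The double sum is split into four series of
  constant sign: the two logarithmic ones give the entropies, since translations preserve the entropy
  of \<open>Q\<close> and since \<open>R\<close> is the average of the translates; the correction terms both have sum \<open>1\<close>.\<close>

lemma convolution_entropy_pairs:
  assumes "set_pmf P \<subseteq> carrier G" "set_pmf Q \<subseteq> carrier G"
    and "finite_entropy G Q" and "finite_entropy G (group_convolution G P Q)"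
  shows "((\<lambda>(x, k). pmf P x * (pmf Q k * ln (pmf Q k)
        - pmf Q k * ln (pmf (group_convolution G P Q) (x \<otimes> k))
        - pmf Q k + pmf (group_convolution G P Q) (x \<otimes> k)))
      has_sum (shannon_entropy G (group_convolution G P Q) - shannon_entropy G Q))
      (carrier G \<times> carrier G)"
proof -
  define R where "R = group_convolution G P Q"
  have R: "set_pmf R \<subseteq> carrier G"
    using set_pmf_group_convolution assms(1,2) by (simp add: R_def)
  have one_P: "(pmf P has_sum 1) (carrier G)" and one_Q: "(pmf Q has_sum 1) (carrier G)"
    and one_R: "(pmf R has_sum 1) (carrier G)"
    using assms(1,2) R by (auto intro: pmf_has_sum_one)
  have minus_ln: "0 \<le> - ln (pmf T g)" for T :: "'a pmf" and g
    by (cases "pmf T g = 0") (auto simp: pmf_nonneg pmf_le_1 less_le)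
  have "((\<lambda>k. pmf Q k * - ln (pmf Q k)) has_sum shannon_entropy G Q) (carrier G)"
    using has_sum_uminusI[OF shannon_entropy_has_sum[OF assms(3)]] by simp
  from has_sum_product_mult_nonneg[OF one_P this]
  have 1: "((\<lambda>(x, k). pmf P x * (pmf Q k * - ln (pmf Q k))) has_sum shannon_entropy G Q)
      (carrier G \<times> carrier G)"
    using minus_ln by (simp add: pmf_nonneg mult_nonneg_nonpos)
  have "((\<lambda>k. pmf R k * - ln (pmf R k)) has_sum shannon_entropy G R) (carrier G)"
    using has_sum_uminusI[OF shannon_entropy_has_sum[OF assms(4)]] by (simp add: R_def)
  then have 2: "((\<lambda>(x, k). pmf P x * pmf Q k * - ln (pmf R (x \<otimes> k))) has_sum shannon_entropy G R)
      (carrier G \<times> carrier G)"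
    unfolding R_def using assms(1,2) minus_ln by (subst convolution_has_sum_iff) auto
  have 3: "((\<lambda>(x, k). pmf P x * pmf Q k) has_sum 1) (carrier G \<times> carrier G)"
    using has_sum_product_mult_nonneg[OF one_P one_Q] by simp
  have "((\<lambda>(x, k). pmf P x * pmf R k) has_sum 1) (carrier G \<times> carrier G)"
    using has_sum_product_mult_nonneg[OF one_P one_R] by simp
  then have 4: "((\<lambda>(x, k). pmf P x * pmf R (x \<otimes> k)) has_sum 1) (carrier G \<times> carrier G)"
    using pair_shear_has_sum[of "\<lambda>(x, k). pmf P x * pmf R k" 1] by simp
  have "((\<lambda>z. (case z of (x, k) \<Rightarrow> pmf P x * pmf Q k * - ln (pmf R (x \<otimes> k)))
        - (case z of (x, k) \<Rightarrow> pmf P x * (pmf Q k * - ln (pmf Q k)))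
        - (case z of (x, k) \<Rightarrow> pmf P x * pmf Q k)
        + (case z of (x, k) \<Rightarrow> pmf P x * pmf R (x \<otimes> k)))
      has_sum (shannon_entropy G R - shannon_entropy G Q - 1 + 1)) (carrier G \<times> carrier G)"
    by (intro has_sum_add has_sum_difference 1 2 3 4)
  then show ?thesis
    unfolding R_def[symmetric] by (simp add: case_prod_unfold algebra_simps)
qed

end


context word_metric_group
begin

lemma mean_length_has_sum:
  assumes "finite_mean_length G S Q"
  shows "((\<lambda>g. pmf Q g * real (word_length G S g)) has_sum mean_length G S Q) (carrier G)"
  using has_sum_infsum[OF assms[unfolded finite_mean_length_def]]
  by (simp add: mean_length_def mult.commute)

lemma mean_length_nonneg: "0 \<le> mean_length G S Q"
  unfolding mean_length_def by (intro infsum_nonneg) auto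

lemma finite_mean_length_convolution:
  assumes "set_pmf P \<subseteq> carrier G" "set_pmf Q \<subseteq> carrier G"
    and "finite_mean_length G S P" "finite_mean_length G S Q"
  shows "finite_mean_length G S (group_convolution G P Q)"
proof -
  have one: "(pmf P has_sum 1) (carrier G)" "(pmf Q has_sum 1) (carrier G)"
    using assms by (auto intro: pmf_has_sum_one)
  have "((\<lambda>(x, k). (pmf P x * real (word_length G S x)) * pmf Q k) has_sum mean_length G S P * 1)
      (carrier G \<times> carrier G)"
    by (intro has_sum_product_mult_nonneg mean_length_has_sum assms one) auto
  moreover have "((\<lambda>(x, k). pmf P x * (pmf Q k * real (word_length G S k))) has_sum 1 * mean_length G S Q)
      (carrier G \<times> carrier G)"
    by (intro has_sum_product_mult_nonneg mean_length_has_sum assms one) auto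
  ultimately have "(\<lambda>z. (case z of (x, k) \<Rightarrow> (pmf P x * real (word_length G S x)) * pmf Q k)
      + (case z of (x, k) \<Rightarrow> pmf P x * (pmf Q k * real (word_length G S k))))
      summable_on carrier G \<times> carrier G"
    by (intro summable_on_add) (auto simp: summable_on_def)
  then have "(\<lambda>(x, k). pmf P x * pmf Q k * real (word_length G S (x \<otimes> k)))
      summable_on carrier G \<times> carrier G"
  proof (rule summable_on_comparison_test)
    fix z assume "z \<in> carrier G \<times> carrier G"
    then obtain x k where z: "z = (x, k)" "x \<in> carrier G" "k \<in> carrier G" by blast
    have "pmf P x * pmf Q k * real (word_length G S (x \<otimes> k))
        \<le> pmf P x * pmf Q k * (real (word_length G S x) + real (word_length G S k))"
      using word_length_mult_le[OF z(2,3)] by (intro mult_left_mono) auto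
    then show "(case z of (x, k) \<Rightarrow> pmf P x * pmf Q k * real (word_length G S (x \<otimes> k)))
        \<le> (case z of (x, k) \<Rightarrow> (pmf P x * real (word_length G S x)) * pmf Q k)
        + (case z of (x, k) \<Rightarrow> pmf P x * (pmf Q k * real (word_length G S k)))"
      by (simp add: z(1) algebra_simps)
  qed auto
  then obtain s where "((\<lambda>(x, k). pmf P x * pmf Q k * real (word_length G S (x \<otimes> k))) has_sum s)
      (carrier G \<times> carrier G)"
    unfolding summable_on_def by blast
  then show ?thesis
    using assms(1,2) by (subst (asm) convolution_has_sum_iff)
      (auto simp: finite_mean_length_def summable_on_def mult.commute)
qed

end

section \<open>Mean length against entropy along a symmetric walk\<close>

locale symmetric_random_walk = word_metric_group G S for G (structure) and S +
  fixes P :: "'a pmf"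
  assumes support: "set_pmf P \<subseteq> carrier G"
    and symmetric: "symmetric_measure G P"
    and second_moment: "finite_second_moment G S P"
begin

definition second_moment_value :: real where
  "second_moment_value = (\<Sum>\<^sub>\<infinity>g\<in>carrier G. pmf P g * (real (word_length G S g))\<^sup>2)"

lemma second_moment_has_sum:
  "((\<lambda>g. pmf P g * (real (word_length G S g))\<^sup>2) has_sum second_moment_value) (carrier G)"
  using has_sum_infsum[OF second_moment[unfolded finite_second_moment_def]]
  by (simp add: second_moment_value_def)

lemma second_moment_nonneg: "0 \<le> second_moment_value"
  unfolding second_moment_value_def by (intro infsum_nonneg) auto

lemma finite_mean_length_step: "finite_mean_length G S P"
  unfolding finite_mean_length_def
proof (rule summable_on_comparison_test[OF second_moment[unfolded finite_second_moment_def]])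
  fix g
  have "real (word_length G S g) \<le> (real (word_length G S g))\<^sup>2"
    by (cases "word_length G S g = 0") (auto intro!: self_le_power)
  then show "real (word_length G S g) * pmf P g \<le> pmf P g * (real (word_length G S g))\<^sup>2"
    by (simp add: mult.commute mult_left_mono)
qed auto

lemma mean_length_terms_at_zero: "real (word_length G S g) * pmf (return_pmf \<one>) g = 0"
  by (cases "g = \<one>") (auto simp: indicator_def word_length_one)

lemma mean_length_at_zero: "mean_length G S (conv_power G P 0) = 0"
  unfolding mean_length_def conv_power.simps mean_length_terms_at_zero by simp

lemma finite_mean_length_walk: "finite_mean_length G S (conv_power G P n)"
proof (induction n)
  case 0
  show ?case
    by (simp only: finite_mean_length_def conv_power.simps mean_length_terms_at_zero summable_on_0)
next
  case (Suc n)
  then show ?case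
    by (simp add: finite_mean_length_convolution support set_pmf_conv_power finite_mean_length_step)
qed

text \<open>Write \<open>l\<close> for the length, \<open>R = P * Q\<close> and \<open>T = P * P * Q\<close>. As \<open>P\<close> is symmetric, a position of law
  \<open>T\<close> arises by undoing a \<open>P\<close>-distributed step \<open>x\<close> from a position of law \<open>R\<close>, so the mean lengths of
  \<open>T\<close> and of \<open>Q\<close> are the sums of \<open>P x * l k\<close> against \<open>R (x \<otimes> k)\<close> and against \<open>Q k\<close>. Replacing \<open>l k\<close>
  by \<open>l (x \<otimes> k)\<close> turns both sums into the mean length of \<open>R\<close>. Subtracting, only the
  difference \<open>l (x \<otimes> k) - l k\<close>, bounded by \<open>l x\<close>, is left against \<open>Q k - R (x \<otimes> k)\<close>, and the pointwise inequality above
  compares this product with the entropy gain and the second moment.\<close>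

lemma mean_length_increment_le:
  assumes Q: "set_pmf Q \<subseteq> carrier G"
    and finite_mean: "finite_mean_length G S Q"
    and entropy: "finite_entropy G Q" "finite_entropy G (group_convolution G P Q)"
    and "0 < c"
  shows "mean_length G S (group_convolution G P (group_convolution G P Q)) - mean_length G S Q
    \<le> c / 2 * (shannon_entropy G (group_convolution G P Q) - shannon_entropy G Q)
      + 2 * second_moment_value / c"
proof -
  define R where "R = group_convolution G P Q"
  define T where "T = group_convolution G P R"
  define l where "l g = real (word_length G S g)" for g
  have R: "set_pmf R \<subseteq> carrier G"
    using set_pmf_group_convolution support Q by (simp add: R_def)
  have finite_mean_R: "finite_mean_length G S R"
    unfolding R_def by (intro finite_mean_length_convolution support Q finite_mean finite_mean_length_step)
  have finite_mean_T: "finite_mean_length G S T"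
    unfolding T_def by (intro finite_mean_length_convolution support R finite_mean_R finite_mean_length_step)
  have mean_Q: "((\<lambda>g. pmf Q g * l g) has_sum mean_length G S Q) (carrier G)"
    and mean_R: "((\<lambda>g. pmf R g * l g) has_sum mean_length G S R) (carrier G)"
    and mean_T: "((\<lambda>g. pmf T g * l g) has_sum mean_length G S T) (carrier G)"
    unfolding l_def by (intro mean_length_has_sum finite_mean finite_mean_R finite_mean_T)+
  have one_P: "(pmf P has_sum 1) (carrier G)" and one_Q: "(pmf Q has_sum 1) (carrier G)"
    and one_R: "(pmf R has_sum 1) (carrier G)"
    using support Q R by (auto intro: pmf_has_sum_one)
  have moment: "((\<lambda>x. pmf P x * (l x)\<^sup>2) has_sum second_moment_value) (carrier G)"
    using second_moment_has_sum by (simp add: l_def)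

  have "((\<lambda>x. pmf P x * pmf R (x \<otimes> k)) has_sum pmf T k) (carrier G)" if k: "k \<in> carrier G" for k
  proof -
    have "((\<lambda>x. pmf P x * pmf R (inv x \<otimes> k)) has_sum pmf T k) (carrier G)"
      unfolding T_def by (rule pmf_group_convolution_has_sum[OF support R k])
    then have "((\<lambda>x. pmf P (inv x) * pmf R (inv (inv x) \<otimes> k)) has_sum pmf T k) (carrier G)"
      using has_sum_reindex_bij_betw[OF bij_betw_inverse,
          of "\<lambda>x. pmf P x * pmf R (inv x \<otimes> k)"] by simp
    also have "?this \<longleftrightarrow> ?thesis"
      using symmetric by (intro has_sum_cong) (simp add: symmetric_measure_def)
    finally show ?thesis .
  qed
  then have T1: "((\<lambda>(x, k). pmf P x * pmf R (x \<otimes> k) * l k) has_sum mean_length G S T)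
      (carrier G \<times> carrier G)"
    by (intro has_sum_product_nonnegI'[OF _ mean_T]) (auto simp: l_def intro!: has_sum_cmult_left)
  have T2: "((\<lambda>(x, k). pmf P x * (pmf Q k * l k)) has_sum 1 * mean_length G S Q)
      (carrier G \<times> carrier G)"
    by (intro has_sum_product_mult_nonneg one_P mean_Q) (auto simp: l_def)
  have "((\<lambda>(x, k). pmf P x * (pmf R k * l k)) has_sum 1 * mean_length G S R)
      (carrier G \<times> carrier G)"
    by (intro has_sum_product_mult_nonneg one_P mean_R) (auto simp: l_def)
  then have T3: "((\<lambda>(x, k). pmf P x * (pmf R (x \<otimes> k) * l (x \<otimes> k))) has_sum 1 * mean_length G S R)
      (carrier G \<times> carrier G)"
    using pair_shear_has_sum[of "\<lambda>(x, k). pmf P x * (pmf R k * l k)"] by simp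
  have T4: "((\<lambda>(x, k). pmf P x * pmf Q k * l (x \<otimes> k)) has_sum mean_length G S R)
      (carrier G \<times> carrier G)"
    by (subst convolution_has_sum_iff) (use support Q mean_R in \<open>auto simp: l_def R_def\<close>)
  have M1: "((\<lambda>(x, k). (pmf P x * (l x)\<^sup>2) * pmf Q k) has_sum second_moment_value * 1)
      (carrier G \<times> carrier G)"
    by (intro has_sum_product_mult_nonneg moment one_Q) auto
  have "((\<lambda>(x, k). (pmf P x * (l x)\<^sup>2) * pmf R k) has_sum second_moment_value * 1)
      (carrier G \<times> carrier G)"
    by (intro has_sum_product_mult_nonneg moment one_R) auto
  then have M2: "((\<lambda>(x, k). (pmf P x * (l x)\<^sup>2) * pmf R (x \<otimes> k)) has_sum second_moment_value * 1)
      (carrier G \<times> carrier G)"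
    using pair_shear_has_sum[of "\<lambda>(x, k). (pmf P x * (l x)\<^sup>2) * pmf R k"] by simp
  note D = convolution_entropy_pairs[OF support Q entropy, folded R_def]

  \<comment> \<open>The last two terms of the left-hand side cancel in total; they centre the length at \<open>x \<otimes> k\<close>.\<close>
  let ?lhs = "\<lambda>z. (case z of (x, k) \<Rightarrow> pmf P x * pmf R (x \<otimes> k) * l k)
      - (case z of (x, k) \<Rightarrow> pmf P x * (pmf Q k * l k))
      - (case z of (x, k) \<Rightarrow> pmf P x * (pmf R (x \<otimes> k) * l (x \<otimes> k)))
      + (case z of (x, k) \<Rightarrow> pmf P x * pmf Q k * l (x \<otimes> k))"
  let ?rhs = "\<lambda>z. c / 2 * (case z of (x, k) \<Rightarrow> pmf P x * (pmf Q k * ln (pmf Q k)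
        - pmf Q k * ln (pmf R (x \<otimes> k)) - pmf Q k + pmf R (x \<otimes> k)))
      + (1 / c * (case z of (x, k) \<Rightarrow> (pmf P x * (l x)\<^sup>2) * pmf Q k)
      + 1 / c * (case z of (x, k) \<Rightarrow> (pmf P x * (l x)\<^sup>2) * pmf R (x \<otimes> k)))"
  have "(?lhs has_sum (mean_length G S T - 1 * mean_length G S Q - 1 * mean_length G S R
      + mean_length G S R)) (carrier G \<times> carrier G)"
    by (intro has_sum_add has_sum_difference T1 T2 T3 T4)
  moreover have "(?rhs has_sum (c / 2 * (shannon_entropy G R - shannon_entropy G Q)
      + (1 / c * (second_moment_value * 1) + 1 / c * (second_moment_value * 1))))
      (carrier G \<times> carrier G)"
    by (intro has_sum_add has_sum_cmult_right D M1 M2)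
  moreover have "?lhs z \<le> ?rhs z" if "z \<in> carrier G \<times> carrier G" for z
  proof -
    obtain x k where z: "z = (x, k)" "x \<in> carrier G" "k \<in> carrier G"
      using \<open>z \<in> carrier G \<times> carrier G\<close> by blast
    have lhs: "?lhs z = pmf P x * ((l (x \<otimes> k) - l k) * (pmf Q k - pmf R (x \<otimes> k)))"
      by (simp add: z(1) algebra_simps)
    have rhs: "?rhs z = pmf P x * (c / 2 * (pmf Q k * ln (pmf Q k)
        - pmf Q k * ln (pmf R (x \<otimes> k)) - pmf Q k + pmf R (x \<otimes> k))
        + (l x)\<^sup>2 * (pmf Q k + pmf R (x \<otimes> k)) / c)"
      using \<open>0 < c\<close> by (simp add: z(1) field_simps)
    show ?thesis
    proof (cases "pmf P x = 0")
      case True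
      then show ?thesis unfolding lhs rhs by simp
    next
      case False
      have "pmf P x * pmf Q k \<le> pmf R (x \<otimes> k)"
        unfolding R_def by (rule group_convolution_mass_ge[OF support Q z(2,3)])
      with False have zero: "pmf Q k = 0" if "pmf R (x \<otimes> k) = 0"
        using that by (simp add: mult_le_0_iff pmf_nonneg less_le)
      have "(l (x \<otimes> k) - l k) * (pmf Q k - pmf R (x \<otimes> k))
          \<le> \<bar>l (x \<otimes> k) - l k\<bar> * \<bar>pmf Q k - pmf R (x \<otimes> k)\<bar>"
        by (metis abs_ge_self abs_mult)
      also have "\<dots> \<le> l x * \<bar>pmf Q k - pmf R (x \<otimes> k)\<bar>"
        using word_length_translation[OF z(2,3)] by (intro mult_right_mono) (auto simp: l_def)
      also have "\<dots> \<le> c / 2 * (pmf Q k * ln (pmf Q k)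
        - pmf Q k * ln (pmf R (x \<otimes> k)) - pmf Q k + pmf R (x \<otimes> k))
        + (l x)\<^sup>2 * (pmf Q k + pmf R (x \<otimes> k)) / c"
        using zero \<open>0 < c\<close> by (intro difference_le_relative_entropy) auto
      finally show ?thesis
        unfolding lhs rhs by (intro mult_left_mono) auto
    qed
  qed
  ultimately have "mean_length G S T - 1 * mean_length G S Q - 1 * mean_length G S R
      + mean_length G S R \<le> c / 2 * (shannon_entropy G R - shannon_entropy G Q)
      + (1 / c * (second_moment_value * 1) + 1 / c * (second_moment_value * 1))"
    by (rule has_sum_mono)
  then show ?thesis
    by (simp add: R_def T_def)
qed

lemma entropy_increment_nonneg:
  assumes Q: "set_pmf Q \<subseteq> carrier G"
    and entropy: "finite_entropy G Q" "finite_entropy G (group_convolution G P Q)"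
  shows "shannon_entropy G Q \<le> shannon_entropy G (group_convolution G P Q)"
proof -
  have "0 \<le> pmf P x * (pmf Q k * ln (pmf Q k) - pmf Q k * ln (pmf (group_convolution G P Q) (x \<otimes> k))
        - pmf Q k + pmf (group_convolution G P Q) (x \<otimes> k))"
    if "x \<in> carrier G" "k \<in> carrier G" for x k
  proof (cases "pmf P x = 0")
    case False
    have "pmf P x * pmf Q k \<le> pmf (group_convolution G P Q) (x \<otimes> k)"
      by (rule group_convolution_mass_ge[OF support Q that])
    with False have "pmf Q k = 0" if "pmf (group_convolution G P Q) (x \<otimes> k) = 0"
      using that by (simp add: mult_le_0_iff pmf_nonneg less_le)
    from order_trans[OF zero_le_power2 relative_entropy_ge_hellinger[OF _ _ this]]
    show ?thesis
      by simp
  qed simp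
  then have "0 \<le> shannon_entropy G (group_convolution G P Q) - shannon_entropy G Q"
    by (intro has_sum_nonneg[OF convolution_entropy_pairs[OF support Q entropy]]) auto
  then show ?thesis by simp
qed

end

section \<open>Entropy against mean length under a volume bound\<close>

lemma summable_exp_minus_powr:
  fixes d :: real
  assumes "0 < d"
  shows "summable (\<lambda>n. exp (- (real n powr d)))"
proof (rule summable_comparison_test_bigo)
  show "summable (\<lambda>n. norm (real n powr - 2))"
    by (simp add: summable_real_powr_iff)
  show "(\<lambda>n. exp (- (real n powr d))) \<in> O(\<lambda>n. real n powr - 2)"
    using assms by real_asymp
qed

text \<open>A crude form of concavity: it replaces Jensen's inequality at the cost of a factor \<open>2\<close> when \<open>a\<close> is
  the mean of \<open>l\<close>.\<close>

lemma powr_le_affine: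
  fixes a d l :: real
  assumes "0 \<le> l" "0 < a" "0 < d" "d \<le> 1"
  shows "l powr d \<le> a powr d + a powr (d - 1) * l"
proof (cases "l \<le> a")
  case True
  then have "l powr d \<le> a powr d" using assms by (intro powr_mono2) auto
  then show ?thesis using assms by (simp add: add_increasing2)
next
  case False
  then have "l powr d = l powr (d - 1) * l"
    using assms by (simp add: powr_diff)
  also have "\<dots> \<le> a powr (d - 1) * l"
    using assms False by (intro mult_right_mono powr_mono2') auto
  finally show ?thesis
    using powr_ge_zero[of a d] by linarith
qed

context word_metric_group
begin

definition growth_at_most :: "real \<Rightarrow> bool" where
  "growth_at_most d \<longleftrightarrow>
     (\<exists>K B. 0 < K \<and> (\<forall>n. real (card (word_ball G S n)) \<le> B * exp (K * real n powr d)))"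

text \<open>On the sphere of radius \<open>n\<close> the weight \<open>exp (- (K + 1) * n powr d)\<close> beats the number of elements
  and leaves a factor \<open>exp (- (n powr d))\<close>.\<close>

lemma stretched_exponential_summable:
  assumes "0 < d"
    and growth: "\<And>n. real (card (word_ball G S n)) \<le> B * exp (K * real n powr d)"
  shows "(\<lambda>g. exp (- ((K + 1) * real (word_length G S g) powr d))) summable_on carrier G"
proof (rule nonneg_bdd_above_summable_on)
  let ?h = "\<lambda>g. exp (- ((K + 1) * real (word_length G S g) powr d))"
  have "0 \<le> B * exp (K * real 0 powr d)"
    using growth[of 0] by (rule order_trans[rotated]) simp
  then have B: "0 \<le> B" by (simp add: zero_le_mult_iff)
  have summable: "summable (\<lambda>n. B * exp (- (real n powr d)))"
    by (intro summable_mult summable_exp_minus_powr assms)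
  have "sum ?h F \<le> (\<Sum>n. B * exp (- (real n powr d)))" if F: "F \<subseteq> carrier G" "finite F" for F
  proof -
    have "sum ?h {g \<in> F. word_length G S g = n} \<le> B * exp (- (real n powr d))" for n
    proof -
      have "card {g \<in> F. word_length G S g = n} \<le> card (word_ball G S n)"
        using F by (intro card_mono finite_word_ball) (auto simp: word_ball_def)
      then have card: "real (card {g \<in> F. word_length G S g = n}) \<le> B * exp (K * real n powr d)"
        using growth[of n] by linarith
      have "sum ?h {g \<in> F. word_length G S g = n}
          = real (card {g \<in> F. word_length G S g = n}) * exp (- ((K + 1) * real n powr d))"
        by simp
      also have "\<dots> \<le> B * exp (K * real n powr d) * exp (- ((K + 1) * real n powr d))"
        by (intro mult_right_mono card) simp
      also have "\<dots> = B * exp (- (real n powr d))"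
        by (simp add: algebra_simps flip: exp_add)
      finally show ?thesis .
    qed
    then have "(\<Sum>n\<in>word_length G S ` F. sum ?h {g \<in> F. word_length G S g = n})
        \<le> (\<Sum>n\<in>word_length G S ` F. B * exp (- (real n powr d)))"
      by (intro sum_mono)
    also have "\<dots> \<le> (\<Sum>n. B * exp (- (real n powr d)))"
      using B F by (intro sum_le_suminf summable) auto
    also have "(\<Sum>n\<in>word_length G S ` F. sum ?h {g \<in> F. word_length G S g = n}) = sum ?h F"
      using F by (intro sum.group) auto
    finally show ?thesis .
  qed
  then show "bdd_above (sum ?h ` {F. F \<subseteq> carrier G \<and> finite F})"
    by (intro bdd_aboveI2) auto
qed auto

text \<open>Gibbs' inequality against the weight \<open>R g = exp (- (K + 1) * l g powr d)\<close>, which is summable by the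
  volume bound: the entropy of \<open>Q\<close> is at most the \<open>Q\<close>-mean of \<open>- ln R\<close> plus the total weight \<open>Z\<close>. That
  mean is a moment of order \<open>d \<le> 1\<close>, hence controlled by the mean length.\<close>

lemma entropy_le_mean_length:
  assumes "0 < d" "d \<le> 1" "growth_at_most d"
  obtains A where "0 < A"
    and "\<And>Q. set_pmf Q \<subseteq> carrier G \<Longrightarrow> finite_mean_length G S Q \<Longrightarrow> finite_entropy G Q"
    and "\<And>Q. set_pmf Q \<subseteq> carrier G \<Longrightarrow> finite_mean_length G S Q \<Longrightarrow>
      shannon_entropy G Q \<le> A + A * mean_length G S Q powr d"
proof -
  obtain K B where K: "0 < K"
    and growth: "\<And>n. real (card (word_ball G S n)) \<le> B * exp (K * real n powr d)"
    using assms(3) unfolding growth_at_most_def by blast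
  define l where "l g = real (word_length G S g)" for g
  define R where "R g = exp (- ((K + 1) * l g powr d))" for g
  define Z where "Z = infsum R (carrier G)"
  have "R summable_on carrier G"
    unfolding R_def l_def by (rule stretched_exponential_summable[OF assms(1) growth])
  then have Z: "(R has_sum Z) (carrier G)"
    unfolding Z_def by (rule has_sum_infsum)
  have Z0: "0 \<le> Z"
    unfolding Z_def R_def by (intro infsum_nonneg) simp
  have main: "finite_entropy G Q \<and>
      shannon_entropy G Q \<le> (2 * (K + 1) + Z) + (2 * (K + 1) + Z) * mean_length G S Q powr d"
    if Q: "set_pmf Q \<subseteq> carrier G" and mean: "finite_mean_length G S Q" for Q
  proof -
    define m where "m = mean_length G S Q"
    \<comment> \<open>The maximum with \<open>1\<close> covers mean length \<open>0\<close>: the affine bound needs \<open>a > 0\<close>.\<close>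
    define a where "a = max 1 m"
    have m: "0 \<le> m" unfolding m_def by (rule mean_length_nonneg)
    have a: "0 < a" "m \<le> a" by (auto simp: a_def)
    have bound: "- (pmf Q g * ln (pmf Q g))
        \<le> (K + 1) * (a powr d * pmf Q g + a powr (d - 1) * (pmf Q g * l g)) - pmf Q g + R g" for g
    proof -
      have "0 \<le> pmf Q g * ln (pmf Q g) - pmf Q g * ln (R g) - pmf Q g + R g"
        by (rule order_trans[OF zero_le_power2 relative_entropy_ge_hellinger]) (auto simp: R_def)
      moreover have "pmf Q g * ((K + 1) * l g powr d)
          \<le> pmf Q g * ((K + 1) * (a powr d + a powr (d - 1) * l g))"
        using K a assms by (intro mult_left_mono powr_le_affine) (auto simp: l_def)
      moreover have "- (pmf Q g * ln (R g)) = pmf Q g * ((K + 1) * l g powr d)"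
        by (simp add: R_def)
      moreover have "pmf Q g * ((K + 1) * (a powr d + a powr (d - 1) * l g))
          = (K + 1) * (a powr d * pmf Q g + a powr (d - 1) * (pmf Q g * l g))"
        by (simp add: algebra_simps)
      ultimately show ?thesis by linarith
    qed
    have total: "((\<lambda>g. (K + 1) * (a powr d * pmf Q g + a powr (d - 1) * (pmf Q g * l g)) - pmf Q g + R g)
        has_sum ((K + 1) * (a powr d * 1 + a powr (d - 1) * m) - 1 + Z)) (carrier G)"
      using mean_length_has_sum[OF mean] unfolding m_def l_def
      by (intro has_sum_add has_sum_difference has_sum_cmult_right pmf_has_sum_one Q Z) auto
    have minus_nonneg: "0 \<le> - (pmf Q g * ln (pmf Q g))" for g
      by (cases "pmf Q g = 0") (auto simp: mult_le_0_iff pmf_nonneg pmf_le_1 less_le)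
    have "(\<lambda>g. - (pmf Q g * ln (pmf Q g))) summable_on carrier G"
      by (rule summable_on_comparison_test[OF has_sum_imp_summable[OF total] bound minus_nonneg])
    then have finite: "finite_entropy G Q"
      by (simp add: finite_entropy_def summable_on_uminus)
    have "((\<lambda>g. - (pmf Q g * ln (pmf Q g))) has_sum shannon_entropy G Q) (carrier G)"
      using has_sum_uminusI[OF shannon_entropy_has_sum[OF finite]] by simp
    from has_sum_mono[OF this total bound]
    have "shannon_entropy G Q \<le> (K + 1) * (a powr d + a powr (d - 1) * m) - 1 + Z"
      by simp
    also have "a powr (d - 1) * m \<le> a powr (d - 1) * a"
      using a by (intro mult_left_mono) auto
    also have "a powr (d - 1) * a = a powr d"
      using a by (simp add: powr_diff)
    also have "a powr d \<le> 1 + m powr d"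
      using m by (cases "m \<le> 1") (auto simp: a_def max_def)
    finally have "shannon_entropy G Q \<le> (K + 1) * (2 * (1 + m powr d)) - 1 + Z"
      using K by simp
    also have "\<dots> \<le> (2 * (K + 1) + Z) + (2 * (K + 1) + Z) * m powr d"
      using K Z0 by (simp add: algebra_simps)
    finally show ?thesis
      using finite by (simp add: m_def)
  qed
  show ?thesis
    by (rule that[of "2 * (K + 1) + Z"]) (use main K Z0 in auto)
qed

end

section \<open>Bounds along the walk\<close>

context symmetric_random_walk
begin

text \<open>The two-step increments telescope along the times of one parity. The intermediate entropies fit
  together because the entropy does not decrease; the first summand \<open>mean_length G S P\<close> is the start of the odd times.\<close>

lemma mean_length_le_entropy:
  assumes finite: "\<And>n. finite_entropy G (conv_power G P n)" and "0 < c"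
  shows "mean_length G S (conv_power G P n)
    \<le> mean_length G S P + c / 2 * shannon_entropy G (conv_power G P n)
      + second_moment_value * real n / c"
proof (induction n rule: induct_nat_012)
  case 0
  then show ?case
    using assms(2) mean_length_at_zero mean_length_nonneg[of P]
      shannon_entropy_nonneg[of "conv_power G P 0"] by simp
next
  case 1
  then show ?case
    using assms(2) group_convolution_one_right[OF support] second_moment_nonneg shannon_entropy_nonneg[of P]
    by simp
next
  case (ge2 n)
  let ?H = "\<lambda>n. shannon_entropy G (conv_power G P n)"
  have "mean_length G S (conv_power G P (Suc (Suc n))) - mean_length G S (conv_power G P n)
      \<le> c / 2 * (?H (Suc n) - ?H n) + 2 * second_moment_value / c"
    using mean_length_increment_le[OF set_pmf_conv_power[OF support] finite_mean_length_walk finite _ assms(2), of n]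
      finite[of "Suc n"] by simp
  moreover have "c / 2 * ?H (Suc n) \<le> c / 2 * ?H (Suc (Suc n))"
    using entropy_increment_nonneg[OF set_pmf_conv_power[OF support] finite, of "Suc n"]
      finite[of "Suc (Suc n)"] assms(2) by (intro mult_left_mono) simp_all
  moreover have "second_moment_value * real (Suc (Suc n)) / c
      = second_moment_value * real n / c + 2 * second_moment_value / c"
    using assms(2) by (simp add: field_simps)
  ultimately show ?case
    using ge2.IH(1) by (simp add: right_diff_distrib)
qed

text \<open>With \<open>l\<close> the mean length at time \<open>n\<close>, the entropy is at most of order \<open>l powr d\<close> by the volume bound.
  Choosing the weight \<open>c\<close> of order \<open>l powr (1 - d)\<close> makes the entropy term equal to \<open>l / 2\<close>, which is
  absorbed on the left, and what remains says that \<open>l powr (2 - d)\<close> is at most of order \<open>n\<close>. Above the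
  threshold \<open>m\<close> the additive constants are absorbed too; below it the claim is trivial for \<open>n > 0\<close>.\<close>

theorem mean_length_walk_le:
  assumes d: "0 < d" "d \<le> 1" and growth: "growth_at_most d"
  shows "\<exists>K>0. \<forall>n. mean_length G S (conv_power G P n) \<le> K * real n powr (1 / (2 - d))"
proof -
  obtain A where A: "0 < A"
    and finite: "\<And>Q. set_pmf Q \<subseteq> carrier G \<Longrightarrow> finite_mean_length G S Q \<Longrightarrow> finite_entropy G Q"
    and entropy_le: "\<And>Q. set_pmf Q \<subseteq> carrier G \<Longrightarrow> finite_mean_length G S Q \<Longrightarrow>
      shannon_entropy G Q \<le> A + A * mean_length G S Q powr d"
    using entropy_le_mean_length[OF d growth] by metis
  note walk = set_pmf_conv_power[OF support] finite_mean_length_walk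
  define C where "C = 8 * A * second_moment_value"
  define m where "m = max 1 (4 * mean_length G S P)"
  define r where "r = 1 / (2 - d)"
  have C: "0 \<le> C" using A second_moment_nonneg by (simp add: C_def)
  have r: "0 < r" using d by (simp add: r_def)
  have "mean_length G S (conv_power G P n) \<le> (m + C powr r) * real n powr r" for n
  proof (cases "n = 0")
    case True
    then show ?thesis using mean_length_at_zero by simp
  next
    case False
    define l where "l = mean_length G S (conv_power G P n)"
    have n: "1 \<le> real n powr r"
      using False r by (intro ge_one_powr_ge_zero) auto
    have "l \<le> max m (C powr r * real n powr r)"
    proof (cases "l \<le> m")
      case False
      then have l: "1 < l" "4 * mean_length G S P < l" by (auto simp: m_def)
      define c where "c = l powr (1 - d) / (2 * A)"
      have c: "0 < c" using l A by (simp add: c_def)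
      have "shannon_entropy G (conv_power G P n) \<le> A + A * l powr d"
        unfolding l_def by (rule entropy_le[OF walk])
      also have "\<dots> \<le> 2 * A * l powr d"
        using A l d ge_one_powr_ge_zero[of l d] by (simp add: mult_le_cancel_left1)
      finally have "c / 2 * shannon_entropy G (conv_power G P n) \<le> c / 2 * (2 * A * l powr d)"
        using c by (intro mult_left_mono) auto
      also have "\<dots> = l / 2"
        using A l by (simp add: c_def powr_diff)
      finally have "l \<le> mean_length G S P + l / 2 + second_moment_value * real n / c"
        using mean_length_le_entropy[OF finite[OF walk] c, of n] by (simp add: l_def)
      then have "l \<le> 4 * (second_moment_value * real n / c)"
        using l by linarith
      then have "l * l powr (1 - d) \<le> C * real n"
        using l A by (simp add: c_def C_def field_simps)
      moreover have "l * l powr (1 - d) = l powr (2 - d)"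
        using l powr_add[of l 1 "1 - d"] by simp
      ultimately have "(l powr (2 - d)) powr r \<le> (C * real n) powr r"
        using r by (intro powr_mono2) auto
      moreover have "(l powr (2 - d)) powr r = l"
        using l d by (simp add: r_def powr_powr)
      moreover have "(C * real n) powr r = C powr r * real n powr r"
        using C by (simp add: powr_mult)
      ultimately show ?thesis by simp
    qed simp
    also have "\<dots> \<le> m * real n powr r + C powr r * real n powr r"
    proof -
      have "m * 1 \<le> m * real n powr r"
        using n by (intro mult_left_mono) (auto simp: m_def)
      then show ?thesis
        using n by (auto simp: m_def max_def intro: add_increasing add_increasing2)
    qed
    finally show ?thesis
      by (simp add: l_def algebra_simps)
  qed
  moreover have "0 < m + C powr r"
    by (simp add: m_def add_pos_nonneg)
  ultimately show ?thesis
    unfolding r_def by blast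
qed

text \<open>By symmetry the return probability at time \<open>2 * n\<close> is the collision probability, the sum of the
  squares of \<open>Q\<close>, that is the \<open>Q\<close>-mean of \<open>exp (ln Q)\<close>. Jensen's inequality for \<open>exp\<close> is applied in the
  form of its tangent at \<open>- H\<close>, the \<open>Q\<close>-mean of \<open>ln Q\<close>.\<close>

lemma return_probability_ge_entropy:
  assumes "finite_entropy G (conv_power G P n)"
  shows "exp (- shannon_entropy G (conv_power G P n)) \<le> pmf (conv_power G P (2 * n)) \<one>"
proof -
  define Q where "Q = conv_power G P n"
  define H where "H = shannon_entropy G Q"
  have Q: "set_pmf Q \<subseteq> carrier G"
    unfolding Q_def by (rule set_pmf_conv_power[OF support])
  have "conv_power G P (2 * n) = group_convolution G Q Q"
    unfolding Q_def mult_2 by (rule conv_power_add[OF support])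
  then have "((\<lambda>x. pmf Q x * pmf Q (inv x \<otimes> \<one>)) has_sum pmf (conv_power G P (2 * n)) \<one>) (carrier G)"
    using pmf_group_convolution_has_sum[OF Q Q one_closed] by simp
  also have "?this \<longleftrightarrow> ((\<lambda>x. pmf Q x * pmf Q x) has_sum pmf (conv_power G P (2 * n)) \<one>) (carrier G)"
    using symmetric_measure_conv_power[OF support symmetric, of n]
    by (intro has_sum_cong) (simp add: symmetric_measure_def Q_def)
  finally have collision: "((\<lambda>x. pmf Q x * pmf Q x) has_sum pmf (conv_power G P (2 * n)) \<one>) (carrier G)" .
  have "((\<lambda>x. exp (- H) * ((1 + H) * pmf Q x + pmf Q x * ln (pmf Q x)))
      has_sum exp (- H) * ((1 + H) * 1 + - H)) (carrier G)"
    using assms unfolding Q_def[symmetric] H_def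
    by (intro has_sum_cmult_right has_sum_add pmf_has_sum_one Q shannon_entropy_has_sum)
  moreover have "exp (- H) * ((1 + H) * pmf Q x + pmf Q x * ln (pmf Q x)) \<le> pmf Q x * pmf Q x" for x
  proof (cases "pmf Q x = 0")
    case False
    then have pos: "0 < pmf Q x" by (simp add: pmf_nonneg less_le)
    have "exp (- H) * (1 + (ln (pmf Q x) + H)) \<le> exp (- H) * exp (ln (pmf Q x) + H)"
      by (intro mult_left_mono exp_ge_add_one_self) simp
    also have "\<dots> = pmf Q x"
      using pos by (simp flip: exp_add)
    finally have "pmf Q x * (exp (- H) * (1 + (ln (pmf Q x) + H))) \<le> pmf Q x * pmf Q x"
      by (intro mult_left_mono) auto
    then show ?thesis by (simp add: algebra_simps)
  qed simp
  ultimately have "exp (- H) * ((1 + H) * 1 + - H) \<le> pmf (conv_power G P (2 * n)) \<one>"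
    using has_sum_mono[OF _ collision] by blast
  then show ?thesis by (simp add: H_def Q_def)
qed

end

section \<open>Growth exponents\<close>

definition upper_order :: "(nat \<Rightarrow> real) \<Rightarrow> real \<Rightarrow> bool" where
  "upper_order f c \<longleftrightarrow> c \<in> {0..1} \<and> (\<exists>K L. K > 0 \<and> (\<forall>n. f n \<le> L + K * real n powr c))"

lemma upper_orderI:
  assumes "0 \<le> c" "c \<le> 1" "0 < K" "\<And>n. f n \<le> L + K * real n powr c"
  shows "upper_order f c"
  unfolding upper_order_def using assms by auto

lemma upper_exponent_eq_Inf: "upper_exponent f = Inf {c. upper_order f c}"
  by (simp add: upper_exponent_def upper_order_def)

lemma upper_exponent_le:
  assumes "upper_order f c"
  shows "upper_exponent f \<le> c"
  unfolding upper_exponent_eq_Inf using assms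
  by (intro cInf_lower bdd_belowI[of _ 0]) (auto simp: upper_order_def)

lemma upper_order_mono:
  assumes "upper_order f c" "c \<le> c'" "c' \<le> 1"
  shows "upper_order f c'"
proof -
  obtain K L where K: "K > 0" and bound: "\<And>n. f n \<le> L + K * real n powr c"
    using assms(1) by (auto simp: upper_order_def)
  have "K * real n powr c \<le> K * real n powr c'" for n
    using K assms(2) by (cases "n = 0") (auto intro!: mult_left_mono powr_mono)
  then have "f n \<le> L + K * real n powr c'" for n
    using bound[of n] by (smt (verit))
  with K assms show ?thesis
    by (intro upper_orderI) (auto simp: upper_order_def)
qed

text \<open>The orders form an upward closed set, so testing the positive ones suffices. This matters because
  the bounds on the walk require a positive volume exponent, whereas the volume may well have order \<open>0\<close>.\<close>

lemma le_upper_exponentI: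
  assumes "upper_order f d"
    and "\<And>c. upper_order f c \<Longrightarrow> 0 < c \<Longrightarrow> x \<le> c"
  shows "x \<le> upper_exponent f"
  unfolding upper_exponent_eq_Inf
proof (rule cInf_greatest)
  show "{c. upper_order f c} \<noteq> {}" using assms(1) by blast
next
  fix c assume "c \<in> {c. upper_order f c}"
  then have c: "upper_order f c" by simp
  then have c01: "0 \<le> c" "c \<le> 1" by (auto simp: upper_order_def)
  show "x \<le> c"
  proof (cases "c = 0")
    case True
    have "x \<le> 0"
    proof (rule ccontr)
      assume "\<not> x \<le> 0"
      define y where "y = min 1 (x / 2)"
      have y: "0 < y" "y \<le> 1" "y < x"
        using \<open>\<not> x \<le> 0\<close> by (auto simp: y_def)
      have "upper_order f y"
        by (rule upper_order_mono[OF c]) (use y True in auto)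
      from assms(2)[OF this y(1)] y(3) show False by simp
    qed
    with True show ?thesis by simp
  next
    case False
    with c01 assms(2)[OF c] show ?thesis by simp
  qed
qed

lemma upper_exponent_bounds:
  assumes "upper_order f d"
  shows "0 \<le> upper_exponent f" "upper_exponent f \<le> 1"
proof -
  show "0 \<le> upper_exponent f" by (rule le_upper_exponentI[OF assms]) simp
  show "upper_exponent f \<le> 1"
    using upper_exponent_le[OF assms] assms by (simp add: upper_order_def)
qed

lemma lower_exponent_le_upper_exponent:
  assumes "\<And>n. 0 \<le> f n" "upper_order f d"
  shows "lower_exponent f \<le> upper_exponent f"
  unfolding lower_exponent_def
proof (rule cSup_least)
  let ?lower = "{c \<in> {0..1}. \<exists>K L. K > 0 \<and> (\<forall>n. L + K * real n powr c \<le> f n)}"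
  have "- 1 + 1 * real n powr 0 \<le> f n" for n
    using assms(1)[of n] by (cases "n = 0") auto
  then have "\<exists>K L. 0 < K \<and> (\<forall>n. L + K * real n powr 0 \<le> f n)"
    using zero_less_one by blast
  then have "0 \<in> ?lower" by simp
  then show "?lower \<noteq> {}" by blast
  fix c assume "c \<in> ?lower"
  then obtain K L where K: "K > 0" and low: "\<And>n. L + K * real n powr c \<le> f n" by auto
  show "c \<le> upper_exponent f"
  proof (rule le_upper_exponentI[OF assms(2)])
    fix c' assume "upper_order f c'" "0 < c'"
    then obtain K' L' where K': "K' > 0" and up: "\<And>n. f n \<le> L' + K' * real n powr c'"
      by (auto simp: upper_order_def)
    show "c \<le> c'"
    proof (rule ccontr)
      assume "\<not> c \<le> c'"
      then have "c' < c" by simp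
      then have "filterlim (\<lambda>n. K * real n powr c - K' * real n powr c') at_top at_top"
        using K K' \<open>0 < c'\<close> by real_asymp
      then have "eventually (\<lambda>n. K * real n powr c - K' * real n powr c' > L' - L) at_top"
        by (simp add: filterlim_at_top_dense)
      then obtain n where "K * real n powr c - K' * real n powr c' > L' - L"
        by (auto simp: eventually_at_top_linorder)
      with low[of n] up[of n] show False by linarith
    qed
  qed
qed

context word_metric_group
begin

lemma growth_at_most_iff_upper_order:
  assumes "0 < d" "d \<le> 1"
  shows "growth_at_most d \<longleftrightarrow> upper_order (\<lambda>n. ln (real (card (word_ball G S n)))) d"
proof
  assume "growth_at_most d"
  then obtain K B where K: "0 < K"
    and growth: "\<And>n. real (card (word_ball G S n)) \<le> B * exp (K * real n powr d)"
    unfolding growth_at_most_def by blast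
  have "0 < B * exp (K * real 0 powr d)"
    using growth[of 0] card_word_ball_ge_one[of 0] by (intro less_le_trans[OF _ growth[of 0]]) auto
  then have B: "0 < B" by (simp add: zero_less_mult_iff)
  have "ln (real (card (word_ball G S n))) \<le> ln B + K * real n powr d" for n
  proof -
    have "ln (real (card (word_ball G S n))) \<le> ln (B * exp (K * real n powr d))"
      using growth[of n] card_word_ball_ge_one[of n] by (intro ln_mono) auto
    with B show ?thesis by (simp add: ln_mult)
  qed
  with K assms show "upper_order (\<lambda>n. ln (real (card (word_ball G S n)))) d"
    unfolding upper_order_def by auto
next
  assume "upper_order (\<lambda>n. ln (real (card (word_ball G S n)))) d"
  then obtain K L where K: "0 < K"
    and bound: "\<And>n. ln (real (card (word_ball G S n))) \<le> L + K * real n powr d"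
    unfolding upper_order_def by blast
  have "real (card (word_ball G S n)) \<le> exp L * exp (K * real n powr d)" for n
  proof -
    have "real (card (word_ball G S n)) = exp (ln (real (card (word_ball G S n))))"
      using card_word_ball_ge_one[of n] by simp
    also have "\<dots> \<le> exp (L + K * real n powr d)"
      using bound[of n] by simp
    finally show ?thesis by (simp add: exp_add)
  qed
  with K show "growth_at_most d"
    unfolding growth_at_most_def by blast
qed

end

context symmetric_random_walk
begin

lemma upper_order_mean_length:
  assumes "0 < d" "d \<le> 1" "growth_at_most d"
  shows "upper_order (\<lambda>n. mean_length G S (conv_power G P n)) (1 / (2 - d))"
proof -
  obtain K where "K > 0" "\<And>n. mean_length G S (conv_power G P n) \<le> K * real n powr (1 / (2 - d))"
    using mean_length_walk_le[OF assms] by blast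
  then show ?thesis
    using assms by (intro upper_orderI[where L = 0 and K = K]) auto
qed

lemma upper_order_entropy:
  assumes d: "0 < d" "d \<le> 1" and growth: "growth_at_most d"
    and "upper_order (\<lambda>n. mean_length G S (conv_power G P n)) c"
  shows "upper_order (\<lambda>n. shannon_entropy G (conv_power G P n)) (c * d)"
proof -
  obtain A where A: "0 < A"
    and entropy_le: "\<And>Q. set_pmf Q \<subseteq> carrier G \<Longrightarrow> finite_mean_length G S Q \<Longrightarrow>
      shannon_entropy G Q \<le> A + A * mean_length G S Q powr d"
    using entropy_le_mean_length[OF d growth] by metis
  obtain K L where K: "K > 0"
    and mean: "\<And>n. mean_length G S (conv_power G P n) \<le> L + K * real n powr c"
    and c: "0 \<le> c" "c \<le> 1"
    using assms(4) by (auto simp: upper_order_def)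
  have "shannon_entropy G (conv_power G P n)
      \<le> (A + A * (2 * \<bar>L\<bar>) powr d) + A * (2 * K) powr d * real n powr (c * d)" for n
  proof -
    have "mean_length G S (conv_power G P n) \<le> max (2 * \<bar>L\<bar>) (2 * K * real n powr c)"
      using mean[of n] by linarith
    then have "mean_length G S (conv_power G P n) powr d \<le> (max (2 * \<bar>L\<bar>) (2 * K * real n powr c)) powr d"
      using d mean_length_nonneg by (intro powr_mono2) auto
    also have "\<dots> \<le> (2 * \<bar>L\<bar>) powr d + (2 * K * real n powr c) powr d"
      by (simp add: max_def)
    also have "(2 * K * real n powr c) powr d = (2 * K) powr d * real n powr (c * d)"
      using K by (simp add: powr_mult powr_powr)
    finally have "A * mean_length G S (conv_power G P n) powr d
        \<le> A * ((2 * \<bar>L\<bar>) powr d + (2 * K) powr d * real n powr (c * d))"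
      using A by (intro mult_left_mono) auto
    with entropy_le[OF set_pmf_conv_power[OF support] finite_mean_length_walk, of n] show ?thesis
      by (simp add: algebra_simps)
  qed
  moreover have "0 < A * (2 * K) powr d" using A K by simp
  moreover have "c * d \<in> {0..1}" using c d by (simp add: mult_le_one)
  ultimately show ?thesis
    unfolding upper_order_def by blast
qed

text \<open>At even times the entropy bounds the return probability. If the walk can return at some odd time
  \<open>k\<close>, then at an odd time \<open>n \<ge> k\<close> it can return at time \<open>k\<close> and then once more after the even time
  \<open>n - k\<close>, at the cost of the constant factor \<open>p k\<close>; the finitely many times before \<open>k\<close> go into the additive
  constant. If it never returns at odd times, the convention \<open>0\<close> applies there.\<close>

lemma upper_order_return_probability:
  assumes finite: "\<And>n. finite_entropy G (conv_power G P n)"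
    and "upper_order (\<lambda>n. shannon_entropy G (conv_power G P n)) c"
  shows "upper_order (\<lambda>n. let p = pmf (conv_power G P n) \<one> in if p = 0 then 0 else - ln p) c"
proof -
  obtain K L where K: "K > 0"
    and entropy: "\<And>n. shannon_entropy G (conv_power G P n) \<le> L + K * real n powr c"
    and c: "0 \<le> c" "c \<le> 1"
    using assms(2) by (auto simp: upper_order_def)
  define p where "p n = pmf (conv_power G P n) \<one>" for n
  define f where "f n = (if p n = 0 then 0 else - ln (p n))" for n
  have p1: "p n \<le> 1" "0 \<le> p n" for n by (auto simp: p_def pmf_le_1)
  have f0: "0 \<le> f n" for n
    using p1[of n] by (auto simp: f_def less_le)
  have mono: "K * real m powr c \<le> K * real n powr c" if "m \<le> n" for m n
    using that K c by (intro mult_left_mono powr_mono2) auto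
  have even: "0 < p (2 * m)" "- ln (p (2 * m)) \<le> L + K * real m powr c" for m
  proof -
    have *: "exp (- shannon_entropy G (conv_power G P m)) \<le> p (2 * m)"
      unfolding p_def by (rule return_probability_ge_entropy[OF finite])
    then show pos: "0 < p (2 * m)"
      using exp_gt_zero less_le_trans by blast
    from * have "- shannon_entropy G (conv_power G P m) \<le> ln (p (2 * m))"
      using pos by (simp add: ln_ge_iff)
    with entropy[of m] show "- ln (p (2 * m)) \<le> L + K * real m powr c" by linarith
  qed
  have "\<exists>M. \<forall>n. f n \<le> M + K * real n powr c"
  proof (cases "\<exists>k. odd k \<and> 0 < p k")
    case True
    then obtain k where k: "odd k" "0 < p k" by blast
    have "f n \<le> (\<bar>L\<bar> - ln (p k) + (\<Sum>i<k. f i)) + K * real n powr c" for n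
    proof -
      have sum0: "0 \<le> (\<Sum>i<k. f i)" by (intro sum_nonneg f0)
      have lnk: "0 \<le> - ln (p k)" using k p1[of k] by simp
      have Kn: "0 \<le> K * real n powr c" using K by simp
      consider m where "n = 2 * m" | "n < k" | m where "n = k + 2 * m"
      proof (cases "even n \<or> n < k")
        case False
        then have "even (n - k)" "n = k + (n - k)" using k by auto
        then show ?thesis using that by (metis evenE)
      qed (use that in \<open>auto elim: evenE\<close>)
      then show ?thesis
      proof cases
        case 1
        have "f n \<le> L + K * real m powr c"
          using even[of m] by (simp add: f_def 1)
        with mono[of m n] 1 sum0 lnk show ?thesis by linarith
      next
        case 2
        have "f n \<le> (\<Sum>i<k. f i)" using 2 f0 by (intro member_le_sum) auto
        with lnk Kn show ?thesis by linarith
      next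
        case 3
        have "p k * p (2 * m) \<le> p n"
          using group_convolution_mass_ge[OF set_pmf_conv_power[OF support] set_pmf_conv_power[OF support],
              of \<one> \<one> k "2 * m"] conv_power_add[OF support, of k "2 * m"]
          by (simp add: p_def 3)
        moreover have "0 < p k * p (2 * m)" using k even[of m] by simp
        ultimately have "0 < p n" and "ln (p k * p (2 * m)) \<le> ln (p n)"
          by auto
        then have "f n \<le> - ln (p k) + - ln (p (2 * m))"
          using k even[of m] by (simp add: f_def ln_mult)
        with even[of m] mono[of m n] 3 sum0 show ?thesis by linarith
      qed
    qed
    then show ?thesis by blast
  next
    case False
    have "f n \<le> \<bar>L\<bar> + K * real n powr c" for n
    proof (cases "even n")
      case True
      then obtain m where n: "n = 2 * m" by (elim evenE)
      have "f n \<le> L + K * real m powr c"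
        using even[of m] by (simp add: f_def n)
      with mono[of m n] n show ?thesis by linarith
    next
      case odd: False
      with False p1(2)[of n] have "p n = 0" by (metis less_eq_real_def)
      then show ?thesis using K by (simp add: f_def)
    qed
    then show ?thesis by blast
  qed
  then obtain M where "\<And>n. f n \<le> M + K * real n powr c" by blast
  with c K have "upper_order f c" by (rule upper_orderI)
  then show ?thesis
    unfolding f_def p_def Let_def .
qed

end


theorem corollary4p5:
  fixes G :: "('a, 'b) monoid_scheme" and S :: "'a set" and P :: "'a pmf"
    and K L \<nu> :: real
  assumes "group G"
    and "finite S" and "symmetric_generating_set G S"
    and "K > 0" and "L > 0" and "0 < \<nu>" and "\<nu> \<le> 1"
    and "\<And>n. real (card (word_ball G S n)) \<le> L * exp (K * real n powr \<nu>)"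
    and "(\<lambda>n. real (card (word_ball G S n))) \<notin> O(\<lambda>n. (real n)\<^sup>2)"
    and "set_pmf P \<subseteq> carrier G"
    and "symmetric_measure G P"
    and "finite_second_moment G S P"
  shows "(\<exists>K' K'' L'' K''' L'''. K' > 0 \<and> K'' > 0 \<and> L'' > 0 \<and> K''' > 0 \<and> L''' > 0 \<and>
           (\<forall>n.
             finite_mean_length G S (conv_power G P n) \<and>
             mean_length G S (conv_power G P n) \<le> K' * real n powr (1 / (2 - \<nu>)) \<and>
             finite_entropy G (conv_power G P n) \<and>
             shannon_entropy G (conv_power G P n) \<le> L'' + K'' * real n powr (\<nu> / (2 - \<nu>)) \<and>
             pmf (conv_power G P (2 * n)) \<one>\<^bsub>G\<^esub> \<ge> exp (- shannon_entropy G (conv_power G P n)) \<and>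
             exp (- shannon_entropy G (conv_power G P n)) \<ge>
               L''' * exp (- K''' * real n powr (\<nu> / (2 - \<nu>))))) \<and>
         beta_lower G S P \<le> beta_upper G S P \<and>
         beta_upper G S P \<le> 1 / (2 - nu_upper G S) \<and>
         gamma_upper G P \<le> eta_upper G P \<and>
         eta_upper G P \<le> beta_upper G S P * nu_upper G S \<and>
         beta_upper G S P * nu_upper G S \<le> nu_upper G S / (2 - nu_upper G S)"
proof -
  interpret group G by fact
  interpret symmetric_random_walk G S P
    by unfold_locales (use assms in auto)
  let ?mean = "\<lambda>n. mean_length G S (conv_power G P n)"
  let ?entropy = "\<lambda>n. shannon_entropy G (conv_power G P n)"
  let ?volume = "\<lambda>n. ln (real (card (word_ball G S n)))"
  have growth: "growth_at_most \<nu>"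
    unfolding growth_at_most_def using assms(4,8) by blast
  obtain A where A: "0 < A"
    and finite_entropy: "\<And>Q. set_pmf Q \<subseteq> carrier G \<Longrightarrow> finite_mean_length G S Q \<Longrightarrow> finite_entropy G Q"
    and entropy_le: "\<And>Q. set_pmf Q \<subseteq> carrier G \<Longrightarrow> finite_mean_length G S Q \<Longrightarrow>
      shannon_entropy G Q \<le> A + A * mean_length G S Q powr \<nu>"
    using entropy_le_mean_length[OF assms(6,7) growth] by metis
  note walk = set_pmf_conv_power[OF support] finite_mean_length_walk
  note finite_entropy_walk = finite_entropy[OF walk]
  obtain K' where K': "0 < K'"
    and mean_le: "\<And>n. ?mean n \<le> K' * real n powr (1 / (2 - \<nu>))"
    using mean_length_walk_le[OF assms(6,7) growth] by blast
  define C where "C = A * K' powr \<nu>"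
  have C: "0 < C" using A K' by (simp add: C_def)
  have entropy_walk_le: "?entropy n \<le> A + C * real n powr (\<nu> / (2 - \<nu>))" for n
  proof -
    have "?mean n powr \<nu> \<le> (K' * real n powr (1 / (2 - \<nu>))) powr \<nu>"
      using assms(6) mean_length_nonneg mean_le by (intro powr_mono2) auto
    also have "\<dots> = K' powr \<nu> * real n powr (\<nu> / (2 - \<nu>))"
      using K' by (simp add: powr_mult powr_powr)
    finally have "A * ?mean n powr \<nu> \<le> C * real n powr (\<nu> / (2 - \<nu>))"
      using A by (simp add: C_def mult.assoc)
    with entropy_le[OF walk, of n] show ?thesis by linarith
  qed
  have bounds: "\<exists>K' K'' L'' K''' L'''. K' > 0 \<and> K'' > 0 \<and> L'' > 0 \<and> K''' > 0 \<and> L''' > 0 \<and>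
           (\<forall>n.
             finite_mean_length G S (conv_power G P n) \<and>
             mean_length G S (conv_power G P n) \<le> K' * real n powr (1 / (2 - \<nu>)) \<and>
             finite_entropy G (conv_power G P n) \<and>
             shannon_entropy G (conv_power G P n) \<le> L'' + K'' * real n powr (\<nu> / (2 - \<nu>)) \<and>
             pmf (conv_power G P (2 * n)) \<one>\<^bsub>G\<^esub> \<ge> exp (- shannon_entropy G (conv_power G P n)) \<and>
             exp (- shannon_entropy G (conv_power G P n)) \<ge>
               L''' * exp (- K''' * real n powr (\<nu> / (2 - \<nu>))))"
  proof (rule exI[of _ K'], rule exI[of _ C], rule exI[of _ A], rule exI[of _ C],
      rule exI[of _ "exp (- A)"], intro conjI allI)
    show "exp (- A) * exp (- C * real n powr (\<nu> / (2 - \<nu>))) \<le> exp (- ?entropy n)" for n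
      using entropy_walk_le[of n] by (simp flip: exp_add)
  qed (use K' C A in \<open>auto intro: finite_mean_length_walk mean_le finite_entropy_walk
      entropy_walk_le return_probability_ge_entropy\<close>)

  have volume: "upper_order ?volume \<nu>"
    using growth growth_at_most_iff_upper_order assms(6,7) by blast
  have growthI: "0 < d \<and> d \<le> 1 \<and> growth_at_most d" if "upper_order ?volume d" "0 < d" for d
    using that growth_at_most_iff_upper_order[of d] by (auto simp: upper_order_def)
  have mean: "upper_order ?mean (1 / (2 - \<nu>))"
    using upper_order_mean_length assms(6,7) growth by blast
  have entropy: "upper_order ?entropy (1 / (2 - \<nu>) * \<nu>)"
    using upper_order_entropy mean assms(6,7) growth by blast
  define b where "b = upper_exponent ?mean"
  define v where "v = upper_exponent ?volume"
  have b: "0 \<le> b" and v: "0 \<le> v" "v \<le> 1"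
    unfolding b_def v_def using upper_exponent_bounds mean volume by blast+

  have lower: "lower_exponent ?mean \<le> b"
    unfolding b_def by (rule lower_exponent_le_upper_exponent[OF mean_length_nonneg mean])
  have beta: "b \<le> 1 / (2 - v)"
  proof (cases "b = 0")
    case False
    with b have "0 < b" by simp
    \<comment> \<open>The bound \<open>b \<le> 1 / (2 - d)\<close> is solved for \<open>d\<close>, so that the infimum over \<open>d\<close> can be taken.\<close>
    have "2 - 1 / b \<le> v"
      unfolding v_def
    proof (rule le_upper_exponentI[OF volume])
      fix d assume "upper_order ?volume d" "0 < d"
      then have d: "0 < d" "d \<le> 1" "growth_at_most d" using growthI by auto
      have "b \<le> 1 / (2 - d)"
        unfolding b_def by (intro upper_exponent_le upper_order_mean_length d)
      with \<open>0 < b\<close> d show "2 - 1 / b \<le> d" by (simp add: field_simps)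
    qed
    with \<open>0 < b\<close> v show ?thesis by (simp add: field_simps)
  qed (use v in simp)
  have gamma: "gamma_upper G P \<le> upper_exponent ?entropy"
    unfolding gamma_upper_def
    by (rule le_upper_exponentI[OF entropy])
      (intro upper_exponent_le upper_order_return_probability finite_entropy_walk)
  have eta_le: "upper_exponent ?entropy \<le> b * d" if "upper_order ?volume d" "0 < d" for d
  proof -
    have d: "0 < d" "d \<le> 1" "growth_at_most d" using growthI that by auto
    have "upper_exponent ?entropy / d \<le> b"
      unfolding b_def
    proof (rule le_upper_exponentI[OF mean])
      fix c assume "upper_order ?mean c"
      then have "upper_exponent ?entropy \<le> c * d"
        by (intro upper_exponent_le upper_order_entropy d)
      with d show "upper_exponent ?entropy / d \<le> c" by (simp add: field_simps)
    qed
    with d show ?thesis by (simp add: field_simps)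
  qed
  have eta: "upper_exponent ?entropy \<le> b * v"
  proof (cases "b = 0")
    case True
    with eta_le[OF volume assms(6)] show ?thesis by simp
  next
    case False
    with b have "0 < b" by simp
    have "upper_exponent ?entropy / b \<le> v"
      unfolding v_def
    proof (rule le_upper_exponentI[OF volume])
      fix d assume "upper_order ?volume d" "0 < d"
      from eta_le[OF this] \<open>0 < b\<close> show "upper_exponent ?entropy / b \<le> d"
        by (simp add: field_simps)
    qed
    with \<open>0 < b\<close> show ?thesis by (simp add: field_simps)
  qed
  have "b * v \<le> v / (2 - v)"
    using mult_right_mono[OF beta v(1)] by simp
  with bounds lower beta gamma eta show ?thesis
    unfolding beta_lower_def beta_upper_def eta_upper_def nu_upper_def b_def v_def by blast
qed

end
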